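(* Let $\xi$ be a positive random variable with density $f$ such that for some positive constants $C$ and $p$, $f(t)\sim Ct^{-p-1}$ as $t\to\infty$. Let $\xi_1,\xi_2$ be independent copies of $\xi$, independent of a one-dimensional Brownian motion $Y$ with $Y_0=0$. Let $\eta_{(-\xi_1,\xi_2)}=\inf\{t\ge0:Y_t\notin(-\xi_1,\xi_2)\}$. Then as $t\to\infty$, $$P(\eta_{(-\xi_1,\xi_2)}>t)\approx\begin{cases}t^{-p},&p<1,\\ t^{-1}\ln t,&p=1,\\ t^{-(p+1)/2},&p>1.\end{cases}$$
   Context: $f\approx g$ as $t\to\infty$ means there exist constants $0<C_1\le C_2$ with $C_1\le f(t)/g(t)\le C_2$ for all sufficiently large $t$; $f\sim g$ means $f/g\to1$. *)

theory Defs
  imports "HOL-Probability.Probability" "HOL-Library.Landau_Symbols"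
begin

definition brownian_motion :: "'a measure \<Rightarrow> (real \<Rightarrow> 'a \<Rightarrow> real) \<Rightarrow> bool" where
  "brownian_motion M Y \<longleftrightarrow>
     prob_space M \<and>
     (\<forall>t. Y t \<in> borel_measurable M) \<and>
     (\<forall>\<omega>\<in>space M. Y 0 \<omega> = 0 \<and> continuous_on {0..} (\<lambda>t. Y t \<omega>)) \<and>
     (\<forall>s t. 0 \<le> s \<and> s < t \<longrightarrow>
        distributed M lborel (\<lambda>\<omega>. Y t \<omega> - Y s \<omega>)
          (\<lambda>x. ennreal (normal_density 0 (sqrt (t - s)) x))) \<and>
     (\<forall>\<tau> :: nat \<Rightarrow> real. 0 \<le> \<tau> 0 \<and> strict_mono \<tau> \<longrightarrow>
        prob_space.indep_vars M (\<lambda>_. borel) (\<lambda>i \<omega>. Y (\<tau> (Suc i)) \<omega> - Y (\<tau> i) \<omega>) UNIV)"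

definition gen_sigma :: "'a measure \<Rightarrow> ('i \<Rightarrow> 'a \<Rightarrow> real) \<Rightarrow> 'a set set" where
  "gen_sigma M X = sigma_sets (space M)
     (\<Union>i. {X i -` A \<inter> space M | A. A \<in> sets borel})"

definition exit_time :: "(real \<Rightarrow> 'a \<Rightarrow> real) \<Rightarrow> ('a \<Rightarrow> real) \<Rightarrow> ('a \<Rightarrow> real) \<Rightarrow> 'a \<Rightarrow> real" where
  "exit_time Y a b \<omega> = Inf {t. 0 \<le> t \<and> Y t \<omega> \<notin> {a \<omega> <..< b \<omega>}}"

definition asymp_comparable :: "(real \<Rightarrow> real) \<Rightarrow> (real \<Rightarrow> real) \<Rightarrow> bool" where
  "asymp_comparable f g \<longleftrightarrow> (\<exists>C1 C2. 0 < C1 \<and> C1 \<le> C2 \<and>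
     (\<forall>\<^sub>F t in at_top. C1 \<le> f t / g t \<and> f t / g t \<le> C2))"

end

theory Submission
  imports Defs
begin

text \<open>
  Write \<open>T = sqrt t\<close>. For fixed barriers the probability of staying in \<open>(-a, b)\<close> up to time \<open>t\<close>
  is at most of order \<open>min 1 (min a b / T) * min 1 (max a b / T) ^ k\<close> for every \<open>k\<close>, and at least of
  order \<open>min 1 (a / T)\<close> when \<open>b \<ge> T\<close>. Both bounds come from comparing a finely sampled path,
  killed outside the region, with an explicit solution of the heat equation: the error function
  for the upper bound and the first sine mode of the strip for the lower bound. By independence the probability
  in question is then comparable to a product of two expectations, one of \<open>min 1 (\<xi> / T)\<close> and one of
  order \<open>T powr - p\<close> (namely \<open>min 1 (\<xi> / T) ^ k\<close> with \<open>k > p\<close>, respectively the tail probability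
  of \<open>\<xi>\<close> at \<open>T\<close>). The three regimes are those of the truncated first moment
  of a density decaying like \<open>x powr (- p - 1)\<close>.
\<close>

section \<open>Gaussian measures on the line\<close>

text \<open>The obstacle is that a sampled path may jump over a barrier, which spoils exact
  identities at the boundary. Neither the reflection principle nor stopping is used: every step of
  the walk pays for the chance of an overshoot longer than a fixed distance \<delta>. For n steps of
  variance of order t / n, the fourth moment makes the total price of order t^2 / (n \<delta>^4),
  which vanishes as the sampling is refined; the second moment would leave a price that does not
  shrink.

  The power k is at one's disposal because each of k increments confined to the strip costs a
  further factor of order \<open>max a b / T\<close>. Once k exceeds p, the mean of
  \<open>min 1 (\<xi> / T) ^ k\<close> is no larger in order than the probability of
  \<open>\<xi> \<ge> T\<close>. So a far barrier shorter than T gains nothing over one longer than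
  T, and demanding \<open>b \<ge> T\<close> in the lower bound loses only a constant. The typical
  scenario is one barrier beyond T, with the other contributing its truncated first moment.\<close>

definition gauss :: "real \<Rightarrow> real measure" where
  "gauss \<sigma> = density lborel (\<lambda>x. ennreal (normal_density 0 \<sigma> x))"

lemma sets_gauss [simp, measurable_cong]: "sets (gauss \<sigma>) = sets borel"
  by (simp add: gauss_def)

lemma space_gauss [simp]: "space (gauss \<sigma>) = UNIV"
  by (simp add: gauss_def)

lemma prob_space_gauss: "\<sigma> > 0 \<Longrightarrow> prob_space (gauss \<sigma>)"
  unfolding gauss_def by (rule prob_space_normal_density)

lemma distr_eq_gauss:
  assumes "distributed M lborel X (\<lambda>x. ennreal (normal_density 0 \<sigma> x))"
  shows "distr M borel X = gauss \<sigma>"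
proof -
  have "distr M borel X = distr M lborel X" by (rule distr_cong) auto
  then show ?thesis using distributed_distr_eq_density[OF assms] by (simp add: gauss_def)
qed

text \<open>The interval has length \<open>2 * x\<close>, and the density never exceeds
  \<open>1 / (2 * \<sigma>)\<close> because 2 pi \<ge> 4. It serves both for an increment confined
  to an interval and for the error function near its zero.\<close>

lemma gauss_ball_le:
  assumes "\<sigma> > 0" "x \<ge> 0"
  shows "measure (gauss \<sigma>) {-x..x} \<le> x / \<sigma>"
proof -
  interpret prob_space "gauss \<sigma>" using assms(1) by (rule prob_space_gauss)
  have dens: "normal_density 0 \<sigma> y \<le> 1 / (2 * \<sigma>)" for y
  proof -
    have "2 * \<sigma> \<le> sqrt (2 * pi * \<sigma>\<^sup>2)"
    proof (rule real_le_rsqrt)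
      have "2\<^sup>2 * \<sigma>\<^sup>2 \<le> (2 * pi) * \<sigma>\<^sup>2"
        using pi_ge_two by (intro mult_right_mono) auto
      then show "(2 * \<sigma>)\<^sup>2 \<le> 2 * pi * \<sigma>\<^sup>2" by (simp add: power_mult_distrib)
    qed
    then have "1 / sqrt (2 * pi * \<sigma>\<^sup>2) \<le> 1 / (2 * \<sigma>)"
      using assms by (intro divide_left_mono) auto
    moreover have "exp (- (y - 0)\<^sup>2 / (2 * \<sigma>\<^sup>2)) \<le> 1" by simp
    ultimately show ?thesis unfolding normal_density_def
      using assms(1) mult_mono[of "1 / sqrt (2 * pi * \<sigma>\<^sup>2)" "1 / (2 * \<sigma>)" "exp (- (y - 0)\<^sup>2 / (2 * \<sigma>\<^sup>2))" 1]
      by simp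
  qed
  have "emeasure (gauss \<sigma>) {-x..x} = (\<integral>\<^sup>+y. ennreal (normal_density 0 \<sigma> y) * indicator {-x..x} y \<partial>lborel)"
    unfolding gauss_def by (simp add: emeasure_density)
  also have "\<dots> \<le> (\<integral>\<^sup>+y. ennreal (1 / (2 * \<sigma>)) * indicator {-x..x} y \<partial>lborel)"
    by (intro nn_integral_mono mult_right_mono) (auto intro!: ennreal_leI dens)
  also have "\<dots> = ennreal (1 / (2 * \<sigma>)) * ennreal (2 * x)"
    using assms by (simp add: nn_integral_cmult_indicator)
  also have "\<dots> = ennreal (x / \<sigma>)"
    using assms by (simp add: ennreal_mult'[symmetric])
  finally show ?thesis
    using assms by (simp add: emeasure_eq_measure)
qed

text \<open>Markov's inequality for the fourth moment; the 3 is the fourth moment of the standard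
  normal law.\<close>

lemma gauss_tail_le:
  assumes "\<sigma> > 0" "\<delta> > 0"
  shows "measure (gauss \<sigma>) {x. \<delta> < \<bar>x\<bar>} \<le> 3 * \<sigma> ^ 4 / \<delta> ^ 4"
proof -
  interpret prob_space "gauss \<sigma>" using assms(1) by (rule prob_space_gauss)
  have m4: "has_bochner_integral lborel (\<lambda>x. normal_density 0 \<sigma> x * (x - 0) ^ (2 * 2)) (fact (2 * 2) / ((2 / \<sigma>\<^sup>2)^2 * fact 2))"
    using assms by (intro normal_moment_even)
  have v: "(fact (2 * 2) / ((2 / \<sigma>\<^sup>2)^2 * fact 2)) = 3 * \<sigma> ^ 4"
    using assms by (simp add: fact_numeral field_simps power2_eq_square eval_nat_numeral)
  have i: "integrable (gauss \<sigma>) (\<lambda>x. x ^ 4)"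
    unfolding gauss_def using m4 has_bochner_integral_iff
    by (subst integrable_real_density) (auto simp: has_bochner_integral_iff)
  have e: "expectation (\<lambda>x. x ^ 4) = 3 * \<sigma> ^ 4"
    unfolding gauss_def using m4 v
    by (subst integral_real_density) (auto simp: has_bochner_integral_iff)
  have "measure (gauss \<sigma>) {x. \<delta> < \<bar>x\<bar>} \<le> prob {x \<in> space (gauss \<sigma>). \<delta> ^ 4 \<le> x ^ 4}"
  proof (rule finite_measure_mono)
    show "{x. \<delta> < \<bar>x\<bar>} \<subseteq> {x \<in> space (gauss \<sigma>). \<delta> ^ 4 \<le> x ^ 4}"
    proof clarsimp
      fix x assume "\<delta> < \<bar>x\<bar>"
      then have "\<delta> ^ 4 \<le> \<bar>x\<bar> ^ 4" using assms by (intro power_mono) auto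
      then show "\<delta> ^ 4 \<le> x ^ 4" by (simp add: power_even_abs)
    qed
  qed auto
  also have "\<dots> \<le> expectation (\<lambda>x. x ^ 4) / \<delta> ^ 4"
    using assms i by (intro integral_Markov_inequality_measure[where A="{}"]) auto
  finally show ?thesis by (simp add: e)
qed

text \<open>Semigroup property of the heat kernel, in terms of distribution functions: after
  exchanging the integrals, the inner one is a convolution of normal densities, whose variances add.
  It is the heat equation for the error function.\<close>

lemma gauss_convolution:
  assumes "\<sigma> > 0" "\<tau> > 0"
  shows "(\<integral>z. measure (gauss \<tau>) {..x - z} \<partial>gauss \<sigma>) = measure (gauss (sqrt (\<tau>\<^sup>2 + \<sigma>\<^sup>2))) {..x}"
proof -
  interpret S: prob_space "gauss \<sigma>" using assms by (intro prob_space_gauss)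
  interpret T: prob_space "gauss \<tau>" using assms by (intro prob_space_gauss)
  interpret U: prob_space "gauss (sqrt (\<tau>\<^sup>2 + \<sigma>\<^sup>2))" 
    using assms by (intro prob_space_gauss) (auto intro!: add_pos_pos)
  have sh: "emeasure (gauss \<tau>) {..x - z} = (\<integral>\<^sup>+u. ennreal (normal_density 0 \<tau> (u - z)) * indicator {..x} u \<partial>lborel)" for z
  proof -
    have "emeasure (gauss \<tau>) {..x - z} = (\<integral>\<^sup>+u. ennreal (normal_density 0 \<tau> u) * indicator {..x - z} u \<partial>lborel)"
      unfolding gauss_def by (simp add: emeasure_density)
    also have "\<dots> = (\<integral>\<^sup>+u. ennreal (normal_density 0 \<tau> (-z + 1 * u)) * indicator {..x - z} (-z + 1 * u) \<partial>lborel)"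
      by (subst nn_integral_real_affine[where c=1 and t="-z"]) (auto simp: one_ennreal_def[symmetric])
    also have "\<dots> = (\<integral>\<^sup>+u. ennreal (normal_density 0 \<tau> (u - z)) * indicator {..x} u \<partial>lborel)"
      by (intro nn_integral_cong) (auto simp: indicator_def)
    finally show ?thesis .
  qed
  have m: "(\<lambda>z. emeasure (gauss \<tau>) {..x - z}) \<in> borel_measurable borel"
    unfolding sh by measurable
  have m': "(\<lambda>z. measure (gauss \<tau>) {..x - z}) \<in> borel_measurable borel"
    using m unfolding measure_def by measurable
  have "(\<integral>\<^sup>+z. emeasure (gauss \<tau>) {..x - z} \<partial>gauss \<sigma>) =
     (\<integral>\<^sup>+z. ennreal (normal_density 0 \<sigma> z) * (\<integral>\<^sup>+u. ennreal (normal_density 0 \<tau> (u - z)) * indicator {..x} u \<partial>lborel) \<partial>lborel)"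
    using m unfolding gauss_def[of \<sigma>] sh by (subst nn_integral_density) auto
  also have "\<dots> = (\<integral>\<^sup>+z. (\<integral>\<^sup>+u. ennreal (normal_density 0 \<tau> (u - z) * normal_density 0 \<sigma> z) * indicator {..x} u \<partial>lborel) \<partial>lborel)"
    by (subst nn_integral_cmult[symmetric]) (auto simp: ennreal_mult' ac_simps)
  also have "\<dots> = (\<integral>\<^sup>+u. (\<integral>\<^sup>+z. ennreal (normal_density 0 \<tau> (u - z) * normal_density 0 \<sigma> z) * indicator {..x} u \<partial>lborel) \<partial>lborel)"
    by (subst lborel_pair.Fubini') auto
  also have "\<dots> = (\<integral>\<^sup>+u. (\<integral>\<^sup>+z. ennreal (normal_density 0 \<tau> (u - z) * normal_density 0 \<sigma> z) \<partial>lborel) * indicator {..x} u \<partial>lborel)"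
    by (subst nn_integral_multc) auto
  also have "\<dots> = (\<integral>\<^sup>+u. ennreal (normal_density 0 (sqrt (\<tau>\<^sup>2 + \<sigma>\<^sup>2)) u) * indicator {..x} u \<partial>lborel)"
    using fun_cong[OF conv_normal_density_zero_mean[OF assms(2,1)]] by simp
  also have "\<dots> = emeasure (gauss (sqrt (\<tau>\<^sup>2 + \<sigma>\<^sup>2))) {..x}"
    unfolding gauss_def by (simp add: emeasure_density)
  finally have "(\<integral>\<^sup>+z. ennreal (measure (gauss \<tau>) {..x - z}) \<partial>gauss \<sigma>) = ennreal (measure (gauss (sqrt (\<tau>\<^sup>2 + \<sigma>\<^sup>2))) {..x})"
    by (simp add: T.emeasure_eq_measure U.emeasure_eq_measure)
  then show ?thesis
    using m' by (intro integral_eq_nn_integral[THEN trans]) (auto)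
qed

text \<open>Substitute u by -u; the endpoint has measure zero. It makes
  \<open>2 * measure (gauss \<sigma>) {..c - y} - 1\<close> odd about \<open>y = c\<close>.\<close>

lemma gauss_symmetric:
  assumes "\<sigma> > 0"
  shows "measure (gauss \<sigma>) {..x} + measure (gauss \<sigma>) {..-x} = 1"
proof -
  interpret S: prob_space "gauss \<sigma>" using assms by (intro prob_space_gauss)
  have "emeasure (gauss \<sigma>) {..-x} = (\<integral>\<^sup>+u. ennreal (normal_density 0 \<sigma> u) * indicator {..-x} u \<partial>lborel)"
    unfolding gauss_def by (simp add: emeasure_density)
  also have "\<dots> = (\<integral>\<^sup>+u. ennreal (normal_density 0 \<sigma> (0 + (-1) * u)) * indicator {..-x} (0 + (-1) * u) \<partial>lborel)"
    by (subst nn_integral_real_affine[where c="-1" and t=0]) (auto simp: one_ennreal_def[symmetric])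
  also have "\<dots> = (\<integral>\<^sup>+u. ennreal (normal_density 0 \<sigma> u) * indicator {x..} u \<partial>lborel)"
    by (intro nn_integral_cong) (auto simp: indicator_def normal_density_def)
  also have "\<dots> = (\<integral>\<^sup>+u. ennreal (normal_density 0 \<sigma> u) * indicator {x<..} u \<partial>lborel)"
    using AE_lborel_singleton[of x]
    by (intro nn_integral_cong_AE) (auto simp: indicator_def elim: eventually_mono)
  also have "\<dots> = emeasure (gauss \<sigma>) {x<..}"
    unfolding gauss_def by (simp add: emeasure_density)
  finally have *: "measure (gauss \<sigma>) {..-x} = measure (gauss \<sigma>) {x<..}"
    by (simp add: S.emeasure_eq_measure)
  have "measure (gauss \<sigma>) {x<..} = 1 - measure (gauss \<sigma>) {..x}"
    using S.prob_compl[of "{..x}"] by (simp add: Compl_eq_Diff_UNIV[symmetric])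
  with * show ?thesis by simp
qed

text \<open>Sines are eigenfunctions of Gaussian averaging, with the characteristic function as
  eigenvalue. After rescaling to variance 1, the addition formula reduces the claim to the real and
  imaginary parts of that function.\<close>

lemma gauss_sin:
  assumes "\<sigma> > 0"
  shows "(\<integral>z. sin (\<alpha> * (y + z)) \<partial>gauss \<sigma>) = exp (- (\<alpha> * \<sigma>)\<^sup>2 / 2) * sin (\<alpha> * y)"
proof -
  interpret S: prob_space "gauss 1" by (intro prob_space_gauss) auto
  interpret S': prob_space "gauss \<sigma>" using assms by (intro prob_space_gauss) auto
  have scale: "gauss \<sigma> = distr (gauss 1) borel (\<lambda>x. \<sigma> * x)"
  proof -
    have "distributed (gauss 1) lborel (\<lambda>x. x) (\<lambda>x. ennreal (normal_density 0 1 x))"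
      unfolding distributed_def gauss_def by (auto intro!: distr_id2)
    from S.normal_density_affine[OF this _ , of \<sigma> 0]
    have "distributed (gauss 1) lborel (\<lambda>x. \<sigma> * x) (\<lambda>x. ennreal (normal_density 0 \<sigma> x))"
      using assms by simp
    then show ?thesis by (rule distr_eq_gauss[symmetric])
  qed
  have sq: "(\<integral>z. cos (\<theta> * z) \<partial>gauss 1) = exp (- \<theta>\<^sup>2 / 2) \<and> (\<integral>z. sin (\<theta> * z) \<partial>gauss 1) = 0" for \<theta>
  proof -
    have "char (gauss 1) \<theta> = complex_of_real (exp (- (\<theta>^2) / 2))"
      using fun_cong[OF char_std_normal_distribution] by (simp add: gauss_def)
    moreover have "integrable (gauss 1) (\<lambda>x. cis (\<theta> * x))"
      by (intro S.integrable_const_bound[where B=1]) (auto simp: cis_conv_exp)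
    ultimately show ?thesis
      unfolding char_def cis_conv_exp[symmetric]
      using integral_Re[of "gauss 1" "\<lambda>x. cis (\<theta> * x)"] integral_Im[of "gauss 1" "\<lambda>x. cis (\<theta> * x)"]
      by (simp add: complex_eq_iff)
  qed
  have i: "integrable (gauss 1) (\<lambda>z. sin (\<theta> * z))" "integrable (gauss 1) (\<lambda>z. cos (\<theta> * z))" for \<theta>
    by (intro S.integrable_const_bound[where B=1]; auto)+
  have "(\<integral>z. sin (\<alpha> * (y + z)) \<partial>gauss \<sigma>) = (\<integral>z. sin (\<alpha> * (y + \<sigma> * z)) \<partial>gauss 1)"
    unfolding scale by (subst integral_distr) auto
  also have "\<dots> = (\<integral>z. sin (\<alpha> * y) * cos ((\<alpha> * \<sigma>) * z) + cos (\<alpha> * y) * sin ((\<alpha> * \<sigma>) * z) \<partial>gauss 1)"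
    by (intro Bochner_Integration.integral_cong refl) (simp add: distrib_left sin_add mult.assoc)
  also have "\<dots> = sin (\<alpha> * y) * exp (- (\<alpha> * \<sigma>)\<^sup>2 / 2)"
    using sq i by (subst Bochner_Integration.integral_add) auto
  finally show ?thesis by simp
qed

section \<open>Killed Gaussian walks\<close>

text \<open>Fubini for the product law: the second argument may be resampled while the first is
  frozen. It is applied to the next step of a walk given its past, and later to the path given the
  barriers.\<close>

lemma (in prob_space)
  fixes g :: "'b \<times> 'b \<Rightarrow> real"
  assumes ind: "indep_var S U T V" and g: "g \<in> borel_measurable (S \<Otimes>\<^sub>M T)"
    and bd: "\<And>z. \<bar>g z\<bar> \<le> B"
  shows borel_measurable_expectation_indep_pair:
      "(\<lambda>\<omega>. expectation (\<lambda>\<omega>'. g (U \<omega>, V \<omega>'))) \<in> borel_measurable M" (is ?A)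
    and expectation_indep_pair:
      "expectation (\<lambda>\<omega>. g (U \<omega>, V \<omega>)) = expectation (\<lambda>\<omega>. expectation (\<lambda>\<omega>'. g (U \<omega>, V \<omega>')))" (is ?B)
proof -
  have rv: "random_variable S U" "random_variable T V"
    and eq: "distr M S U \<Otimes>\<^sub>M distr M T V = distr M (S \<Otimes>\<^sub>M T) (\<lambda>x. (U x, V x))"
    using ind unfolding indep_var_distribution_eq by auto
  note [measurable] = rv g
  interpret DU: prob_space "distr M S U" by (rule prob_space_distr) fact
  interpret DV: prob_space "distr M T V" by (rule prob_space_distr) fact
  interpret P: pair_prob_space "distr M S U" "distr M T V" ..
  have g': "g \<in> borel_measurable (distr M S U \<Otimes>\<^sub>M distr M T V)" using g by simp
  have int: "integrable (distr M S U \<Otimes>\<^sub>M distr M T V) g"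
    using bd by (intro P.integrable_const_bound[where B=B]) (auto simp: g')
  have meas: "(\<lambda>u. \<integral>v. g (u, v) \<partial>distr M T V) \<in> borel_measurable S"
    using DV.borel_measurable_lebesgue_integral[of "\<lambda>u v. g (u, v)" S] by simp
  have inner: "(\<integral>v. g (U \<omega>, v) \<partial>distr M T V) = expectation (\<lambda>\<omega>'. g (U \<omega>, V \<omega>'))"
    if "\<omega> \<in> space M" for \<omega>
    using measurable_space[OF rv(1) that] by (intro integral_distr) auto
  have "(\<lambda>\<omega>. \<integral>v. g (U \<omega>, v) \<partial>distr M T V) \<in> borel_measurable M"
    using measurable_compose[OF rv(1) meas] .
  then show ?A by (subst (asm) measurable_cong[OF inner])
  have "expectation (\<lambda>\<omega>. g (U \<omega>, V \<omega>)) = (\<integral>z. g z \<partial>distr M (S \<Otimes>\<^sub>M T) (\<lambda>x. (U x, V x)))"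
    by (subst integral_distr) auto
  also have "\<dots> = (\<integral>u. (\<integral>v. g (u, v) \<partial>distr M T V) \<partial>distr M S U)"
    using P.integral_fst'[OF int] by (simp add: eq)
  also have "\<dots> = expectation (\<lambda>\<omega>. \<integral>v. g (U \<omega>, v) \<partial>distr M T V)"
    using meas by (subst integral_distr) auto
  also have "\<dots> = expectation (\<lambda>\<omega>. expectation (\<lambda>\<omega>'. g (U \<omega>, V \<omega>')))"
    using inner by (intro Bochner_Integration.integral_cong refl)
  finally show ?B .
qed

text \<open>A discrete maximum principle: \<open>h\<close> solves the heat equation along the walk, and the
  walk is killed on leaving \<open>A\<close>. Since \<open>h\<close> has a sign only near \<open>A\<close>, large overshoots
  cost \<open>\<epsilon>\<close> per step.\<close>

lemma (in prob_space) killed_walk_le: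
  fixes X :: "nat \<Rightarrow> 'a \<Rightarrow> real" and h :: "nat \<Rightarrow> real \<Rightarrow> real" and n :: nat
  assumes ind: "indep_vars (\<lambda>_. borel) X UNIV"
    and law: "\<And>i. i < n \<Longrightarrow> distr M borel (X i) = gauss \<sigma>"
    and overshoot: "measure (gauss \<sigma>) {x. \<delta> < \<bar>x\<bar>} \<le> \<epsilon>"
    and A: "A \<in> sets borel" "0 \<in> A"
    and h: "\<And>j. h j \<in> borel_measurable borel" "\<And>j y. \<bar>h j y\<bar> \<le> 1"
    and heat: "\<And>j y. (\<integral>z. h j (y + z) \<partial>gauss \<sigma>) = h (Suc j) y"
    and near: "\<And>j x y. x \<in> A \<Longrightarrow> y \<notin> A \<Longrightarrow> \<bar>y - x\<bar> \<le> \<delta> \<Longrightarrow> 0 \<le> h j y"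
  shows "expectation (\<lambda>\<omega>. indicator {\<omega>. \<forall>k\<le>n. (\<Sum>i<k. X i \<omega>) \<in> A} \<omega> * h 0 (\<Sum>i<n. X i \<omega>))
    \<le> h n 0 + real n * \<epsilon>"
proof -
  note [measurable] = A(1) h(1)
  have [measurable]: "random_variable borel (X i)" for i
    using ind by (auto simp: indep_vars_def)
  define S where "S k \<omega> = (\<Sum>i<k. X i \<omega>)" for k \<omega>
  define E where "E k = {\<omega>\<in>space M. \<forall>j\<le>k. S j \<omega> \<in> A}" for k
  have [measurable]: "random_variable borel (S k)" for k unfolding S_def by measurable
  have [measurable]: "E k \<in> events" for k unfolding E_def by measurable
  \<comment> \<open>\<open>G k\<close> kills the walk during its first k steps only and replaces the
    remaining n - k steps by the heat solution, so it interpolates between \<open>h n 0\<close> at k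
    = 0 and the left-hand side at k = n.\<close>
  define G where "G k = expectation (\<lambda>\<omega>. indicator (E k) \<omega> * h (n - k) (S k \<omega>))" for k
  have SS: "S (Suc k) \<omega> = S k \<omega> + X k \<omega>" for k \<omega> by (simp add: S_def)
  have step: "G (Suc k) \<le> G k + \<epsilon>" if k: "k < n" for k
  proof -
    \<comment> \<open>The past enters as one random variable in a product space; survival up to step
      k is a set there, and the independent next increment can be averaged out.\<close>
    let ?B = "PiM {..<k} (\<lambda>_. borel :: real measure)"
    let ?U = "\<lambda>\<omega>. restrict (\<lambda>i. X i \<omega>) {..<k}"
    define Q where "Q = {u \<in> space ?B. \<forall>j\<le>k. (\<Sum>i<j. u i) \<in> A}"
    have mk: "(\<lambda>u. \<Sum>i<j. u i) \<in> borel_measurable ?B" if "j \<le> k" for j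
      using that by (intro borel_measurable_sum) auto
    have Q[measurable]: "Q \<in> sets ?B"
    proof -
      have "{u \<in> space ?B. \<forall>j\<in>{..k}. (\<Sum>i<j. u i) \<in> A} \<in> sets ?B"
        using measurable_sets[OF mk A(1)] by (intro sets.sets_Collect_finite_All') (auto simp: vimage_def Int_def conj_commute)
      then show ?thesis by (simp add: Q_def Ball_def)
    qed
    have sumU: "(\<Sum>i<j. ?U \<omega> i) = S j \<omega>" if "j \<le> k" for j \<omega>
      unfolding S_def using that by (intro sum.cong) auto
    have QE: "indicator Q (?U \<omega>) = (indicator (E k) \<omega> :: real)" if "\<omega> \<in> space M" for \<omega>
      using that sumU by (auto simp: Q_def E_def indicator_def space_PiM)
    have "indep_var ?B ?U (PiM {k} (\<lambda>_. borel)) (\<lambda>\<omega>. restrict (\<lambda>i. X i \<omega>) {k})"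
      using indep_var_restrict[OF ind, of "{..<k}" "{k}"] by auto
    note iv = this
    let ?V = "\<lambda>\<omega>. restrict (\<lambda>i. X i \<omega>) {k}"
    let ?g = "\<lambda>(u, v). indicator Q u * h (n - Suc k) ((\<Sum>i<k. u i) + v k)"
    have gm: "?g \<in> borel_measurable (?B \<Otimes>\<^sub>M PiM {k} (\<lambda>_. borel))"
      using mk[of k] by measurable
    have inner: "expectation (\<lambda>\<omega>'. h (n - Suc k) (y + X k \<omega>')) = h (n - k) y" for y
    proof -
      have "expectation (\<lambda>\<omega>'. h (n - Suc k) (y + X k \<omega>')) = (\<integral>z. h (n - Suc k) (y + z) \<partial>distr M borel (X k))"
        by (subst integral_distr) auto
      then show ?thesis unfolding law[OF k] heat using k by (simp add: Suc_diff_Suc)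
    qed
    have "expectation (\<lambda>\<omega>. indicator (E k) \<omega> * h (n - Suc k) (S (Suc k) \<omega>)) = expectation (\<lambda>\<omega>. ?g (?U \<omega>, ?V \<omega>))"
      using QE sumU[of k] by (intro Bochner_Integration.integral_cong refl) (simp add: SS)
    also have "\<dots> = expectation (\<lambda>\<omega>. expectation (\<lambda>\<omega>'. ?g (?U \<omega>, ?V \<omega>')))"
      by (rule expectation_indep_pair[OF iv gm, where B=1]) (use h(2) in \<open>auto simp: indicator_def\<close>)
    also have "\<dots> = G k"
      unfolding G_def using inner QE sumU[of k]
      by (intro Bochner_Integration.integral_cong refl) simp
    finally have Gk: "G k = expectation (\<lambda>\<omega>. indicator (E k) \<omega> * h (n - Suc k) (S (Suc k) \<omega>))" ..
    have i: "integrable M (\<lambda>\<omega>. indicator (E i) \<omega> * h j (S l \<omega>))" for i j l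
      by (intro integrable_const_bound[where B=1]) (use h(2) in \<open>auto simp: indicator_def\<close>)
    have i': "integrable M (indicator {\<omega>\<in>space M. \<delta> < \<bar>X k \<omega>\<bar>} :: _ \<Rightarrow> real)"
      by (intro integrable_const_bound[where B=1]) auto
    have "G (Suc k) \<le> expectation (\<lambda>\<omega>. indicator (E k) \<omega> * h (n - Suc k) (S (Suc k) \<omega>)
        + indicator {\<omega>\<in>space M. \<delta> < \<bar>X k \<omega>\<bar>} \<omega>)"
      unfolding G_def
    proof (rule integral_mono)
      fix \<omega> assume \<omega>: "\<omega> \<in> space M"
      \<comment> \<open>Passing from \<open>E k\<close> to \<open>E (Suc k)\<close> discards the
        paths that leave at this step. It can raise the mean only where \<open>h\<close> is
        negative; such values are at least -1 and require a jump longer than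
        \<open>\<delta>\<close>.\<close>
      have "0 \<le> h (n - Suc k) (S (Suc k) \<omega>)" if "\<omega> \<in> E k" "\<omega> \<notin> E (Suc k)" "\<bar>X k \<omega>\<bar> \<le> \<delta>"
      proof (rule near)
        show "S k \<omega> \<in> A" using that by (auto simp: E_def)
        show "S (Suc k) \<omega> \<notin> A" using that \<omega> by (auto simp: E_def le_Suc_eq)
        show "\<bar>S (Suc k) \<omega> - S k \<omega>\<bar> \<le> \<delta>" using that by (simp add: SS)
      qed
      moreover have "\<omega> \<in> E (Suc k) \<Longrightarrow> \<omega> \<in> E k" by (auto simp: E_def)
      ultimately show "indicator (E (Suc k)) \<omega> * h (n - Suc k) (S (Suc k) \<omega>)
        \<le> indicator (E k) \<omega> * h (n - Suc k) (S (Suc k) \<omega>) + indicator {\<omega>\<in>space M. \<delta> < \<bar>X k \<omega>\<bar>} \<omega>"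
        using h(2)[of "n - Suc k" "S (Suc k) \<omega>"] \<omega>
        by (cases "\<omega> \<in> E k"; cases "\<omega> \<in> E (Suc k)") (auto simp: indicator_def)
    qed (auto intro!: Bochner_Integration.integrable_add i i')
    also have "\<dots> = G k + prob {\<omega>\<in>space M. \<delta> < \<bar>X k \<omega>\<bar>}"
      unfolding Gk using i i' by (subst Bochner_Integration.integral_add) auto
    also have "prob {\<omega>\<in>space M. \<delta> < \<bar>X k \<omega>\<bar>} = measure (distr M borel (X k)) {x. \<delta> < \<bar>x\<bar>}"
      by (subst measure_distr) (auto simp: vimage_def Int_def conj_commute)
    finally show ?thesis using overshoot law[OF k] by simp
  qed
  have "k \<le> n \<Longrightarrow> G k \<le> G 0 + real k * \<epsilon>" for k
  proof (induction k)
    case (Suc k)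
    then show ?case using step[of k] by (simp add: algebra_simps)
  qed simp
  from this[of n] have "G n \<le> G 0 + real n * \<epsilon>" by simp
  moreover have "G 0 = h n 0"
    unfolding G_def E_def S_def using A by (simp add: prob_space cong: Bochner_Integration.integral_cong)
  moreover have "G n = expectation (\<lambda>\<omega>. indicator {\<omega>. \<forall>k\<le>n. (\<Sum>i<k. X i \<omega>) \<in> A} \<omega> * h 0 (\<Sum>i<n. X i \<omega>))"
    unfolding G_def E_def S_def by (intro Bochner_Integration.integral_cong refl) (auto simp: indicator_def)
  ultimately show ?thesis by simp
qed

text \<open>The terminal value is 1 on the survival event, so \<open>killed_walk_le\<close> bounds
  its probability directly. The first term is the error function at distance \<open>2 * b\<close>
  from its zero, the second the chance that one of n jumps exceeds \<open>b\<close>.\<close>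

lemma (in prob_space) gaussian_walk_below_le:
  fixes X :: "nat \<Rightarrow> 'a \<Rightarrow> real" and n :: nat
  assumes ind: "indep_vars (\<lambda>_. borel) X UNIV"
    and law: "\<And>i. i < n \<Longrightarrow> distr M borel (X i) = gauss \<sigma>"
    and pos: "\<sigma> > 0" "b > 0" "n > 0"
  shows "prob {\<omega>\<in>space M. \<forall>k\<le>n. (\<Sum>i<k. X i \<omega>) < b} \<le> 2 * b / (\<sigma> * sqrt n) + n * (3 * \<sigma> ^ 4 / b ^ 4)"
proof -
  \<comment> \<open>The antisymmetric heat solution vanishing at \<open>c\<close>; placing \<open>c\<close> a distance \<open>b\<close>
    beyond the barrier makes it nonnegative after overshoots of at most \<open>b\<close>.\<close>
  define c where "c = 2 * b"
  \<comment> \<open>\<open>h j y\<close> is the mean of \<open>h 0\<close> at a walk started in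
    \<open>y\<close> after j steps. The case j = 0 is separate because \<open>gauss 0\<close> is the
    zero measure and not a point mass.\<close>
  define h where "h j y = (if j = 0 then (if y \<le> c then 1 else -1)
      else 2 * measure (gauss (\<sigma> * sqrt (real j))) {..c - y} - 1)" for j :: nat and y
  have ps: "prob_space (gauss (\<sigma> * sqrt (real j)))" if "j \<noteq> 0" for j
    using pos that by (intro prob_space_gauss) auto
  have mono: "y \<le> y' \<Longrightarrow> h j y' \<le> h j y" for j y y'
  proof (cases "j = 0")
    case False
    interpret T: prob_space "gauss (\<sigma> * sqrt (real j))" using False by (rule ps)
    show "y \<le> y' \<Longrightarrow> h j y' \<le> h j y"
      unfolding h_def using False by (auto intro!: T.finite_measure_mono)
  qed (auto simp: h_def)
  have hm: "h j \<in> borel_measurable borel" for j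
  proof -
    have "(\<lambda>y. - h j y) \<in> borel_measurable borel"
      by (rule borel_measurable_mono) (auto simp: mono_def mono)
    then show ?thesis by simp
  qed
  have hb: "\<bar>h j y\<bar> \<le> 1" for j y
  proof (cases "j = 0")
    case False
    interpret T: prob_space "gauss (\<sigma> * sqrt (real j))" using False by (rule ps)
    show ?thesis unfolding h_def using False T.prob_le_1[of "{..c - y}"] measure_nonneg[of _ "{..c - y}"]
      by (auto simp: abs_le_iff)
  qed (auto simp: h_def)
  interpret S: prob_space "gauss \<sigma>" using pos by (intro prob_space_gauss)
  have heat: "(\<integral>z. h j (y + z) \<partial>gauss \<sigma>) = h (Suc j) y" for j y
  proof (cases "j = 0")
    case True
    have "(\<integral>z. h j (y + z) \<partial>gauss \<sigma>) = (\<integral>z. 2 * indicator {..c - y} z - 1 \<partial>gauss \<sigma>)"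
      unfolding h_def using True by (intro Bochner_Integration.integral_cong refl) (auto simp: indicator_def)
    also have "\<dots> = 2 * measure (gauss \<sigma>) {..c - y} - 1"
      by (subst Bochner_Integration.integral_diff)
        (auto simp: S.prob_space[simplified] intro!: S.integrable_const_bound[where B=1])
    finally show ?thesis using True by (simp add: h_def)
  next
    case False
    let ?\<tau> = "\<sigma> * sqrt (real j)"
    interpret T: prob_space "gauss ?\<tau>" using False by (rule ps)
    have "(\<integral>z. h j (y + z) \<partial>gauss \<sigma>) = (\<integral>z. 2 * measure (gauss ?\<tau>) {..(c - y) - z} - 1 \<partial>gauss \<sigma>)"
      unfolding h_def using False by (intro Bochner_Integration.integral_cong refl) (auto simp: algebra_simps)
    also have "\<dots> = 2 * (\<integral>z. measure (gauss ?\<tau>) {..(c - y) - z} \<partial>gauss \<sigma>) - 1"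
    proof -
      have "(\<lambda>z. - measure (gauss ?\<tau>) {..(c - y) - z}) \<in> borel_measurable borel"
        by (rule borel_measurable_mono) (auto simp: mono_def intro!: T.finite_measure_mono)
      then have "(\<lambda>z. measure (gauss ?\<tau>) {..(c - y) - z}) \<in> borel_measurable borel" by simp
      then have "integrable (gauss \<sigma>) (\<lambda>z. measure (gauss ?\<tau>) {..(c - y) - z})"
        by (intro S.integrable_const_bound[where B=1]) auto
      then show ?thesis by (subst Bochner_Integration.integral_diff) (auto simp: S.prob_space[simplified])
    qed
    also have "(\<integral>z. measure (gauss ?\<tau>) {..(c - y) - z} \<partial>gauss \<sigma>) = measure (gauss (sqrt (?\<tau>\<^sup>2 + \<sigma>\<^sup>2))) {..c - y}"
      using pos False by (intro gauss_convolution) auto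
    also have "sqrt (?\<tau>\<^sup>2 + \<sigma>\<^sup>2) = \<sigma> * sqrt (real (Suc j))"
    proof -
      have "?\<tau>\<^sup>2 + \<sigma>\<^sup>2 = \<sigma>\<^sup>2 * real (Suc j)" by (simp add: power_mult_distrib algebra_simps)
      then show ?thesis using pos by (simp add: real_sqrt_mult)
    qed
    finally show ?thesis by (simp add: h_def)
  qed
  have nonneg: "0 \<le> h j y" if "y \<le> c" for j y
  proof (cases "j = 0")
    case False
    interpret T: prob_space "gauss (\<sigma> * sqrt (real j))" using False by (rule ps)
    have "measure (gauss (\<sigma> * sqrt (real j))) {..-(c - y)} \<le> measure (gauss (\<sigma> * sqrt (real j))) {..c - y}"
      using that by (intro T.finite_measure_mono) auto
    then show ?thesis
      using gauss_symmetric[of "\<sigma> * sqrt (real j)" "c - y"] pos False by (simp add: h_def)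
  qed (use that in \<open>auto simp: h_def\<close>)
  have "expectation (\<lambda>\<omega>. indicator {\<omega>. \<forall>k\<le>n. (\<Sum>i<k. X i \<omega>) \<in> {..<b}} \<omega> * h 0 (\<Sum>i<n. X i \<omega>))
      \<le> h n 0 + real n * (3 * \<sigma> ^ 4 / b ^ 4)"
    using pos hm hb heat by (intro killed_walk_le[OF ind law gauss_tail_le, where \<delta>=b]) (auto simp: c_def intro!: nonneg)
  also have "expectation (\<lambda>\<omega>. indicator {\<omega>. \<forall>k\<le>n. (\<Sum>i<k. X i \<omega>) \<in> {..<b}} \<omega> * h 0 (\<Sum>i<n. X i \<omega>))
      = expectation (indicator {\<omega>\<in>space M. \<forall>k\<le>n. (\<Sum>i<k. X i \<omega>) < b})"
    using pos by (intro Bochner_Integration.integral_cong refl)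
      (auto simp: indicator_def h_def c_def dest!: spec[of _ n])
  also have "\<dots> = prob {\<omega>\<in>space M. \<forall>k\<le>n. (\<Sum>i<k. X i \<omega>) < b}"
    by (simp add: Int_def conj_commute)
  also have "h n 0 \<le> c / (\<sigma> * sqrt n)"
  proof -
    let ?\<tau> = "\<sigma> * sqrt (real n)"
    have \<tau>: "?\<tau> > 0" using pos by simp
    interpret T: prob_space "gauss ?\<tau>" using pos by (intro ps) auto
    have "measure (gauss ?\<tau>) {..c} \<le> measure (gauss ?\<tau>) ({..-c} \<union> {-c..c})"
      by (intro T.finite_measure_mono) auto
    also have "\<dots> \<le> measure (gauss ?\<tau>) {..-c} + measure (gauss ?\<tau>) {-c..c}"
      by (rule measure_Un_le) auto
    finally have "measure (gauss ?\<tau>) {..c} - measure (gauss ?\<tau>) {..-c} \<le> c / ?\<tau>"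
      using gauss_ball_le[OF \<tau>, of c] pos by (simp add: c_def)
    then show ?thesis using gauss_symmetric[OF \<tau>, of c] pos by (simp add: h_def)
  qed
  finally show ?thesis by (simp add: c_def)
qed

text \<open>The sine mode shrinks by the same factor in each step, so its mean is explicit. Applying
  \<open>killed_walk_le\<close> to its negative yields a lower bound, and since the mode is at most
  1, its mean on the survival event is at most the survival probability.\<close>

lemma (in prob_space) gaussian_walk_strip_ge:
  fixes X :: "nat \<Rightarrow> 'a \<Rightarrow> real" and n :: nat
  assumes ind: "indep_vars (\<lambda>_. borel) X UNIV"
    and law: "\<And>i. i < n \<Longrightarrow> distr M borel (X i) = gauss \<sigma>"
    and pos: "\<sigma> > 0" "a > 0" "b > 0"
  shows "exp (- (pi / (a + b) * \<sigma>)\<^sup>2 * n / 2) * sin (pi * a / (a + b)) - n * (3 * \<sigma> ^ 4 / (a + b) ^ 4)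
    \<le> prob {\<omega>\<in>space M. \<forall>k\<le>n. (\<Sum>i<k. X i \<omega>) \<in> {-a<..<b}}"
proof -
  have [measurable]: "random_variable borel (X i)" for i
    using ind by (auto simp: indep_vars_def)
  define L where "L = a + b"
  define \<alpha> where "\<alpha> = pi / L"
  have L: "L > 0" using pos by (simp add: L_def)
  \<comment> \<open>The first Dirichlet eigenfunction of the strip has the wrong sign only after overshoots
    beyond the strip's width.\<close>
  define h where "h j y = - (exp (- (\<alpha> * \<sigma>)\<^sup>2 * real j / 2) * sin (\<alpha> * (y + a)))" for j :: nat and y
  have hb: "\<bar>h j y\<bar> \<le> 1" for j y
    unfolding h_def by (auto simp: abs_mult intro!: mult_le_one)
  have heat: "(\<integral>z. h j (y + z) \<partial>gauss \<sigma>) = h (Suc j) y" for j y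
  proof -
    have "(\<integral>z. h j (y + z) \<partial>gauss \<sigma>) = - (exp (- (\<alpha> * \<sigma>)\<^sup>2 * real j / 2) * (\<integral>z. sin (\<alpha> * ((y + a) + z)) \<partial>gauss \<sigma>))"
      by (simp add: h_def add_ac)
    also have "\<dots> = - ((exp (- (\<alpha> * \<sigma>)\<^sup>2 * real j / 2) * exp (- (\<alpha> * \<sigma>)\<^sup>2 / 2)) * sin (\<alpha> * (y + a)))"
      using pos by (simp add: gauss_sin)
    also have "\<dots> = h (Suc j) y"
      unfolding h_def exp_add[symmetric] by (simp add: algebra_simps add_divide_distrib)
    finally show ?thesis .
  qed
  have hm: "h j \<in> borel_measurable borel" for j
    unfolding h_def by measurable
  have near: "0 \<le> h j y" if "x \<in> {-a<..<b}" "y \<notin> {-a<..<b}" "\<bar>y - x\<bar> \<le> L" for j x y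
  proof -
    have "sin (\<alpha> * (y + a)) \<le> 0"
    proof (cases "y \<le> -a")
      case True
      have "-L \<le> y + a" using that by auto
      then have "\<alpha> * (-L) \<le> \<alpha> * (y + a)" using L by (intro mult_left_mono) (auto simp: \<alpha>_def)
      then have "-pi \<le> \<alpha> * (y + a)" using L by (simp add: \<alpha>_def)
      moreover have "\<alpha> * (y + a) \<le> 0" using True L by (intro mult_nonneg_nonpos) (auto simp: \<alpha>_def)
      ultimately have "0 \<le> sin (- (\<alpha> * (y + a)))" by (intro sin_ge_zero) auto
      then show ?thesis by simp
    next
      case False
      then have "L \<le> y + a" "y + a \<le> 2 * L" using that by (auto simp: L_def)
      then have "\<alpha> * L \<le> \<alpha> * (y + a)" and "\<alpha> * (y + a) \<le> \<alpha> * (2 * L)"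
        using L by (intro mult_left_mono; simp add: \<alpha>_def)+
      moreover have "\<alpha> * L = pi" "\<alpha> * (2 * L) = 2 * pi" using L by (simp_all add: \<alpha>_def)
      ultimately have "pi \<le> \<alpha> * (y + a)" "\<alpha> * (y + a) \<le> 2 * pi" by simp_all
      then have "0 \<le> sin (\<alpha> * (y + a) - pi)" by (intro sin_ge_zero) auto
      then show ?thesis by (simp add: sin_diff)
    qed
    then show ?thesis by (auto simp: h_def intro!: mult_nonneg_nonpos)
  qed
  let ?E = "{\<omega>\<in>space M. \<forall>k\<le>n. (\<Sum>i<k. X i \<omega>) \<in> {-a<..<b}}"
  have "expectation (\<lambda>\<omega>. indicator {\<omega>. \<forall>k\<le>n. (\<Sum>i<k. X i \<omega>) \<in> {-a<..<b}} \<omega> * h 0 (\<Sum>i<n. X i \<omega>))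
      \<le> h n 0 + real n * (3 * \<sigma> ^ 4 / L ^ 4)"
    using pos hb heat L hm near
    by (intro killed_walk_le[OF ind law gauss_tail_le, where \<delta>=L and h=h and A="{-a<..<b}"]) (simp; fail | blast)+
  moreover have "- prob ?E \<le> expectation (\<lambda>\<omega>. indicator {\<omega>. \<forall>k\<le>n. (\<Sum>i<k. X i \<omega>) \<in> {-a<..<b}} \<omega> * h 0 (\<Sum>i<n. X i \<omega>))"
  proof -
    have "- prob ?E = expectation (\<lambda>\<omega>. - indicator ?E \<omega>)"
      by (simp add: Int_def conj_commute)
    also have "\<dots> \<le> expectation (\<lambda>\<omega>. indicator ?E \<omega> * h 0 (\<Sum>i<n. X i \<omega>))"
    proof (rule integral_mono)
      show "integrable M (\<lambda>\<omega>. indicator ?E \<omega> * h 0 (\<Sum>i<n. X i \<omega>))"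
      proof (rule integrable_const_bound[where B=1])
        show "AE \<omega> in M. norm (indicator ?E \<omega> * h 0 (\<Sum>i<n. X i \<omega>)) \<le> 1"
          using hb by (auto simp: indicator_def)
      qed (unfold h_def, measurable)
      show "- indicator ?E \<omega> \<le> indicator ?E \<omega> * h 0 (\<Sum>i<n. X i \<omega>)" for \<omega>
        using hb[of 0 "\<Sum>i<n. X i \<omega>"] by (auto simp: indicator_def abs_le_iff)
      show "integrable M (\<lambda>\<omega>. - indicator ?E \<omega> :: real)"
        by (rule integrable_const_bound[where B=1]) (auto simp: indicator_def)
    qed
    also have "\<dots> = expectation (\<lambda>\<omega>. indicator {\<omega>. \<forall>k\<le>n. (\<Sum>i<k. X i \<omega>) \<in> {-a<..<b}} \<omega> * h 0 (\<Sum>i<n. X i \<omega>))"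
      by (intro Bochner_Integration.integral_cong refl) (auto simp: indicator_def)
    finally show ?thesis .
  qed
  ultimately have "- prob ?E \<le> h n 0 + real n * (3 * \<sigma> ^ 4 / L ^ 4)" by linarith
  then show ?thesis by (simp add: h_def \<alpha>_def L_def)
qed

section \<open>Brownian motion in a strip\<close>

definition grid :: "real \<Rightarrow> real set" where
  "grid t = {t * real k / 2 ^ n | k n. k \<le> 2 ^ n}"

lemma countable_grid: "countable (grid t)"
proof -
  have "grid t \<subseteq> (\<lambda>(k, n). t * real k / 2 ^ n) ` UNIV" by (auto simp: grid_def)
  then show ?thesis by (rule countable_subset) auto
qed

lemma grid_nonempty: "grid t \<noteq> {}"
proof -
  have "t * real 0 / 2 ^ 0 \<in> grid t" unfolding grid_def by force
  then show ?thesis by blast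
qed

lemma grid_subset: "t \<ge> 0 \<Longrightarrow> grid t \<subseteq> {0..t}"
proof
  fix s assume t: "t \<ge> 0" and "s \<in> grid t"
  then obtain k n where s: "s = t * real k / 2 ^ n" and k: "k \<le> 2 ^ n" by (auto simp: grid_def)
  have "real k \<le> 2 ^ n" using k by (metis of_nat_le_iff of_nat_numeral of_nat_power)
  then have "t * real k \<le> t * 2 ^ n" using t by (rule mult_left_mono)
  then show "s \<in> {0..t}" using t by (auto simp: s field_simps)
qed

text \<open>Round \<open>s / t\<close> down to a multiple of \<open>1 / 2 ^ n\<close>.\<close>

lemma grid_dense:
  assumes "s \<in> {0..t}"
  shows "\<exists>x. (\<forall>n. x n \<in> grid t) \<and> x \<longlonglongrightarrow> s"
proof (cases "t = 0")
  case True
  then have "s = 0" "0 \<in> grid t" using assms by (auto simp: grid_def intro: exI[of _ 0])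
  then show ?thesis by (intro exI[of _ "\<lambda>_. 0"]) auto
next
  case False
  then have t: "t > 0" using assms by auto
  define r where "r = s / t"
  have r: "0 \<le> r" "r \<le> 1" using assms t by (auto simp: r_def)
  define k where "k n = nat \<lfloor>r * 2 ^ n\<rfloor>" for n :: nat
  have k1: "real (k n) \<le> r * 2 ^ n" "r * 2 ^ n \<le> real (k n) + 1" for n
    unfolding k_def using r by (auto simp: of_nat_nat)
  have "real (k n) \<le> 2 ^ n" for n
  proof -
    have "r * 2 ^ n \<le> 1 * 2 ^ n" using r by (intro mult_right_mono) auto
    then have "real (k n) \<le> 2 ^ n" using k1(1)[of n] by linarith
    then show ?thesis .
  qed
  then have k2: "k n \<le> 2 ^ n" for n
    by (metis of_nat_le_iff of_nat_numeral of_nat_power)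
  have lim: "(\<lambda>n. real (k n) / 2 ^ n) \<longlonglongrightarrow> r"
  proof (rule tendsto_sandwich)
    show "\<forall>\<^sub>F n in sequentially. r - (1/2) ^ n \<le> real (k n) / 2 ^ n"
    proof (intro always_eventually allI)
      fix n
      have "r - (1/2) ^ n = (r * 2 ^ n - 1) / 2 ^ n" by (simp add: power_one_over field_simps)
      also have "\<dots> \<le> real (k n) / 2 ^ n" using k1(2)[of n] by (intro divide_right_mono) auto
      finally show "r - (1/2) ^ n \<le> real (k n) / 2 ^ n" .
    qed
    show "\<forall>\<^sub>F n in sequentially. real (k n) / 2 ^ n \<le> r"
      using k1(1) by (intro always_eventually) (auto simp: field_simps)
    have "(\<lambda>n. r - (1/2::real) ^ n) \<longlonglongrightarrow> r - 0"
      by (intro tendsto_diff tendsto_const LIMSEQ_realpow_zero) auto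
    then show "(\<lambda>n. r - (1/2::real) ^ n) \<longlonglongrightarrow> r" by simp
  qed auto
  have "(\<lambda>n. t * (real (k n) / 2 ^ n)) \<longlonglongrightarrow> t * r"
    by (intro tendsto_mult tendsto_const lim)
  then show ?thesis using k2 t
    by (intro exI[of _ "\<lambda>n. t * real (k n) / 2 ^ n"]) (auto simp: grid_def r_def)
qed

text \<open>A supremum over countably many times is measurable even for the sigma-algebra generated
  by the path alone, which independence from the barriers requires. For a continuous path it is the
  maximum over [0, t].\<close>

definition run_sup :: "(real \<Rightarrow> 'a \<Rightarrow> real) \<Rightarrow> real \<Rightarrow> 'a \<Rightarrow> real" where
  "run_sup Y t \<omega> = (SUP s\<in>grid t. Y s \<omega>)"

lemma bdd_above_grid:
  fixes y :: "real \<Rightarrow> real"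
  assumes "t \<ge> 0" "continuous_on {0..} y"
  shows "bdd_above (y ` grid t)"
proof -
  have "compact (y ` {0..t})"
    using assms(2) by (intro compact_continuous_image) (auto intro: continuous_on_subset)
  then have "bdd_above (y ` {0..t})" by (intro bounded_imp_bdd_above compact_imp_bounded)
  then show ?thesis by (rule bdd_above_mono) (use grid_subset[OF assms(1)] in auto)
qed

text \<open>Density and continuity give that no value on [0, t] exceeds \<open>run_sup\<close>.
  Conversely the inequality stays strict because the maximum over the compact interval is
  attained.\<close>

lemma run_sup_less_iff:
  assumes t: "t \<ge> 0" and c: "continuous_on {0..} (\<lambda>t. Y t \<omega>)"
  shows "run_sup Y t \<omega> < b \<longleftrightarrow> (\<forall>s\<in>{0..t}. Y s \<omega> < b)"
proof
  assume less: "run_sup Y t \<omega> < b"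
  show "\<forall>s\<in>{0..t}. Y s \<omega> < b"
  proof
    fix s assume s: "s \<in> {0..t}"
    from grid_dense[OF this] obtain x where x: "\<And>n. x n \<in> grid t" "x \<longlonglongrightarrow> s" by blast
    have "(\<lambda>n. Y (x n) \<omega>) \<longlonglongrightarrow> Y s \<omega>"
    proof (rule continuous_on_tendsto_compose[OF c x(2)])
      show "\<forall>\<^sub>F n in sequentially. x n \<in> {0..}"
        using x(1) grid_subset[OF t] by (intro always_eventually) fastforce
    qed (use s in auto)
    then have "Y s \<omega> \<le> run_sup Y t \<omega>"
      using x unfolding run_sup_def
      by (intro LIMSEQ_le_const2) (auto intro!: cSUP_upper bdd_above_grid[OF t c])
    then show "Y s \<omega> < b" using less by simp
  qed
next
  assume less: "\<forall>s\<in>{0..t}. Y s \<omega> < b"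
  obtain x where x: "x \<in> {0..t}" "\<forall>y\<in>{0..t}. Y y \<omega> \<le> Y x \<omega>"
    using continuous_attains_sup[of "{0..t}" "\<lambda>t. Y t \<omega>"] continuous_on_subset[OF c, of "{0..t}"] t by auto
  have "run_sup Y t \<omega> \<le> Y x \<omega>"
    unfolding run_sup_def using x grid_subset[OF t] by (intro cSUP_least grid_nonempty) auto
  then show "run_sup Y t \<omega> < b" using less x by force
qed

lemma run_sup_measurable:
  assumes "\<And>s. Y s \<in> borel_measurable N" "t \<ge> 0"
    and "\<And>\<omega>. \<omega> \<in> space N \<Longrightarrow> continuous_on {0..} (\<lambda>t. Y t \<omega>)"
  shows "run_sup Y t \<in> borel_measurable N"
  unfolding run_sup_def[abs_def]
  by (rule borel_measurable_cSUP) (use assms countable_grid bdd_above_grid in auto)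

text \<open>Phrased through two running suprema, so that with random barriers the event is a
  comparison of two pairs of real random variables, one for the barriers and one for the
  path.\<close>

definition stay :: "'a measure \<Rightarrow> (real \<Rightarrow> 'a \<Rightarrow> real) \<Rightarrow> real \<Rightarrow> real \<Rightarrow> real \<Rightarrow> 'a set" where
  "stay M Y t a b = {\<omega>\<in>space M. run_sup (\<lambda>s \<omega>. - Y s \<omega>) t \<omega> < a \<and> run_sup Y t \<omega> < b}"

section \<open>Strip probabilities for deterministic barriers\<close>

context
  fixes M :: "'a measure" and Y :: "real \<Rightarrow> 'a \<Rightarrow> real"
  assumes BM: "brownian_motion M Y"
begin

lemma bm_prob_space: "prob_space M"
  using BM by (simp add: brownian_motion_def)

lemma bm_measurable: "Y t \<in> borel_measurable M"
  using BM by (simp add: brownian_motion_def)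

lemma bm_zero: "\<omega> \<in> space M \<Longrightarrow> Y 0 \<omega> = 0"
  using BM by (simp add: brownian_motion_def)

lemma bm_continuous: "\<omega> \<in> space M \<Longrightarrow> continuous_on {0..} (\<lambda>t. Y t \<omega>)"
  using BM by (simp add: brownian_motion_def)

lemma bm_increment_law:
  "0 \<le> s \<Longrightarrow> s < t \<Longrightarrow>
    distributed M lborel (\<lambda>\<omega>. Y t \<omega> - Y s \<omega>) (\<lambda>x. ennreal (normal_density 0 (sqrt (t - s)) x))"
  using BM unfolding brownian_motion_def by blast

lemma bm_increments_indep:
  "0 \<le> \<tau> 0 \<Longrightarrow> strict_mono \<tau> \<Longrightarrow>
    prob_space.indep_vars M (\<lambda>_. borel) (\<lambda>i \<omega>. Y (\<tau> (Suc i)) \<omega> - Y (\<tau> i) \<omega>) UNIV"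
  using BM unfolding brownian_motion_def by blast

lemma stay_eq:
  "t \<ge> 0 \<Longrightarrow> stay M Y t a b = {\<omega>\<in>space M. \<forall>s\<in>{0..t}. - a < Y s \<omega> \<and> Y s \<omega> < b}"
  unfolding stay_def
proof (intro Collect_cong conj_cong refl)
  fix \<omega> assume t: "t \<ge> 0" and \<omega>: "\<omega> \<in> space M"
  have "run_sup Y t \<omega> < b \<longleftrightarrow> (\<forall>s\<in>{0..t}. Y s \<omega> < b)"
    by (rule run_sup_less_iff[where Y=Y and \<omega>=\<omega>, OF t bm_continuous[OF \<omega>]])
  moreover have "run_sup (\<lambda>s \<omega>. - Y s \<omega>) t \<omega> < a \<longleftrightarrow> (\<forall>s\<in>{0..t}. - Y s \<omega> < a)"
    by (rule run_sup_less_iff[where Y="\<lambda>s \<omega>. - Y s \<omega>" and \<omega>=\<omega>, OF t continuous_on_minus[OF bm_continuous[OF \<omega>]]])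
  moreover have "- Y s \<omega> < a \<longleftrightarrow> - a < Y s \<omega>" for s by linarith
  ultimately show "(run_sup (\<lambda>s \<omega>. - Y s \<omega>) t \<omega> < a \<and> run_sup Y t \<omega> < b) \<longleftrightarrow> (\<forall>s\<in>{0..t}. - a < Y s \<omega> \<and> Y s \<omega> < b)"
    by blast
qed

lemma stay_measurable:
  assumes "t \<ge> 0"
  shows "stay M Y t a b \<in> sets M"
proof -
  have [measurable]: "run_sup Y t \<in> borel_measurable M" "run_sup (\<lambda>s \<omega>. - Y s \<omega>) t \<in> borel_measurable M"
    using assms bm_continuous bm_measurable by (auto intro!: run_sup_measurable continuous_intros borel_measurable_uminus)
  show ?thesis unfolding stay_def by measurable
qed

lemma bm_increments:
  assumes "\<tau> 0 = 0" "strict_mono \<tau>"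
  shows "prob_space.indep_vars M (\<lambda>_. borel) (\<lambda>i \<omega>. Y (\<tau> (Suc i)) \<omega> - Y (\<tau> i) \<omega>) UNIV"
    and "distr M borel (\<lambda>\<omega>. Y (\<tau> (Suc i)) \<omega> - Y (\<tau> i) \<omega>) = gauss (sqrt (\<tau> (Suc i) - \<tau> i))"
    and "\<omega> \<in> space M \<Longrightarrow> (\<Sum>i<k. Y (\<tau> (Suc i)) \<omega> - Y (\<tau> i) \<omega>) = Y (\<tau> k) \<omega>"
proof -
  have "0 \<le> \<tau> i" for i using assms strict_mono_less_eq[of \<tau> 0 i] by auto
  moreover have "\<tau> i < \<tau> (Suc i)" using assms by (auto simp: strict_mono_less)
  ultimately show "distr M borel (\<lambda>\<omega>. Y (\<tau> (Suc i)) \<omega> - Y (\<tau> i) \<omega>) = gauss (sqrt (\<tau> (Suc i) - \<tau> i))"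
    by (intro distr_eq_gauss bm_increment_law)
  show "prob_space.indep_vars M (\<lambda>_. borel) (\<lambda>i \<omega>. Y (\<tau> (Suc i)) \<omega> - Y (\<tau> i) \<omega>) UNIV"
    using assms by (intro bm_increments_indep) auto
  show "(\<Sum>i<k. Y (\<tau> (Suc i)) \<omega> - Y (\<tau> i) \<omega>) = Y (\<tau> k) \<omega>" if "\<omega> \<in> space M"
    using bm_zero[OF that] assms by (subst sum_lessThan_telescope) simp
qed

text \<open>The first half of \<open>[0, t]\<close> only uses the barrier \<open>b\<close>, on a fine grid of \<open>n\<close> steps;
  the second half only uses that \<open>k\<close> independent increments are bounded by the width.\<close>

lemma bm_strip_le_aux:
  fixes k n :: nat
  assumes t: "t > 0" and ab: "a > 0" "b > 0" and k: "k > 0" and n: "n > 0"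
  shows "measure M (stay M Y t a b) \<le> min 1 (2 * sqrt 2 * b / sqrt t + 3 * (t/2)\<^sup>2 / (real n * b ^ 4))
     * (min 1 ((a + b) * sqrt (2 * k) / sqrt t)) ^ k"
proof -
  interpret prob_space M by (rule bm_prob_space)
  note [measurable] = bm_measurable
  \<comment> \<open>n steps of length t / (2 n) fill the first half, then steps of length t / (2 k)
    follow; index n + k is time t. The formula runs on past t because independence of increments is
    stated for infinite increasing sequences of times.\<close>
  define \<tau> where "\<tau> i = (if i \<le> n then (t/2) * i / n else t/2 + (t/2) * (real i - real n) / k)" for i
  have sm: "strict_mono \<tau>"
  proof (rule strict_monoI_Suc)
    fix i show "\<tau> i < \<tau> (Suc i)"
    proof (cases "Suc i \<le> n")
      case True then show ?thesis using t n by (auto simp: \<tau>_def divide_strict_right_mono)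
    next
      case False
      then have "\<tau> i = t/2 + (t/2) * (real i - real n) / k" "\<tau> (Suc i) = t/2 + (t/2) * (real (Suc i) - real n) / k"
        using n by (auto simp: \<tau>_def not_less_eq_eq le_antisym)
      then show ?thesis using t k by (auto simp: divide_strict_right_mono)
    qed
  qed
  have t0: "\<tau> 0 = 0" by (simp add: \<tau>_def)
  define X where "X i \<omega> = Y (\<tau> (Suc i)) \<omega> - Y (\<tau> i) \<omega>" for i \<omega>
  note inc = bm_increments[OF t0 sm, folded X_def]
  have [measurable]: "random_variable borel (X i)" for i unfolding X_def by measurable
  have \<tau>1: "\<tau> (Suc i) - \<tau> i = t / (2 * n)" if "i < n" for i
    using that n by (auto simp: \<tau>_def field_simps)
  have \<tau>2: "\<tau> (Suc i) - \<tau> i = t / (2 * k)" if "n \<le> i" for i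
    using that n k by (auto simp: \<tau>_def field_simps not_less_eq_eq le_antisym)
  have \<tau>3: "\<tau> i \<in> {0..t}" if "i \<le> n + k" for i
  proof -
    have "\<tau> 0 \<le> \<tau> i" "\<tau> i \<le> \<tau> (n + k)" using that strict_mono_less_eq[OF sm] by auto
    moreover have "\<tau> (n + k) = t" using k n by (auto simp: \<tau>_def)
    ultimately show ?thesis using t0 by auto
  qed
  let ?A = "PiM {..<n} (\<lambda>_. borel :: real measure)" and ?B = "PiM {n..<n+k} (\<lambda>_. borel :: real measure)"
  define L where "L = a + b"
  define E where "E = {\<omega>\<in>space M. \<forall>j\<le>n. (\<Sum>i<j. X i \<omega>) < b}"
  define F where "F = {\<omega>\<in>space M. \<forall>i\<in>{n..<n+k}. X i \<omega> \<in> {-L..L}}"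
  define QE where "QE = {u\<in>space ?A. \<forall>j\<in>{..n}. (\<Sum>i<j. u i) < b}"
  define QF where "QF = {u\<in>space ?B. \<forall>i\<in>{n..<n+k}. u i \<in> {-L..L}}"
  have mk: "(\<lambda>u. \<Sum>i<j. u i) \<in> borel_measurable ?A" if "j \<in> {..n}" for j
    using that by (intro borel_measurable_sum) auto
  have QE: "QE \<in> sets ?A"
    unfolding QE_def using mk by (intro sets.sets_Collect_finite_All') auto
  have QF: "QF \<in> sets ?B"
    unfolding QF_def by (intro sets.sets_Collect_finite_All') (use k in auto)
  have "indep_var ?A (\<lambda>\<omega>. restrict (\<lambda>i. X i \<omega>) {..<n}) ?B (\<lambda>\<omega>. restrict (\<lambda>i. X i \<omega>) {n..<n+k})"
    by (rule indep_var_restrict[OF inc(1)]) auto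
  from indep_varD[OF this QE QF]
  have "prob ((\<lambda>\<omega>. (restrict (\<lambda>i. X i \<omega>) {..<n}, restrict (\<lambda>i. X i \<omega>) {n..<n+k})) -` (QE \<times> QF) \<inter> space M)
     = prob ((\<lambda>\<omega>. restrict (\<lambda>i. X i \<omega>) {..<n}) -` QE \<inter> space M) * prob ((\<lambda>\<omega>. restrict (\<lambda>i. X i \<omega>) {n..<n+k}) -` QF \<inter> space M)" .
  moreover have "(\<lambda>\<omega>. restrict (\<lambda>i. X i \<omega>) {..<n}) -` QE \<inter> space M = E"
    unfolding QE_def E_def by (auto simp: space_PiM)
  moreover have "(\<lambda>\<omega>. restrict (\<lambda>i. X i \<omega>) {n..<n+k}) -` QF \<inter> space M = F"
    unfolding QF_def F_def by (auto simp: space_PiM)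
  moreover have "(\<lambda>\<omega>. (restrict (\<lambda>i. X i \<omega>) {..<n}, restrict (\<lambda>i. X i \<omega>) {n..<n+k})) -` (QE \<times> QF) \<inter> space M = 
     ((\<lambda>\<omega>. restrict (\<lambda>i. X i \<omega>) {..<n}) -` QE \<inter> space M) \<inter> ((\<lambda>\<omega>. restrict (\<lambda>i. X i \<omega>) {n..<n+k}) -` QF \<inter> space M)"
    by auto
  ultimately have EF: "prob (E \<inter> F) = prob E * prob F" by simp
  have F: "prob F = (\<Prod>i\<in>{n..<n+k}. prob (X i -` {-L..L} \<inter> space M))"
  proof -
    have "F = (\<Inter>i\<in>{n..<n+k}. X i -` {-L..L} \<inter> space M)" unfolding F_def using k by auto
    then show ?thesis using k by (simp only:) (rule indep_varsD[OF inc(1)], auto)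
  qed
  \<comment> \<open>A coarse increment has variance t / (2 k); this is the origin of
    \<open>sqrt (2 * k)\<close>.\<close>
  have each: "prob (X i -` {-L..L} \<inter> space M) \<le> min 1 ((a + b) * sqrt (2 * k) / sqrt t)" if "i \<in> {n..<n+k}" for i
  proof -
    have "prob (X i -` {-L..L} \<inter> space M) = measure (distr M borel (X i)) {-L..L}"
      by (subst measure_distr) auto
    also have "\<dots> \<le> L / sqrt (t / (2 * k))"
    proof -
      have "distr M borel (X i) = gauss (sqrt (t / (2 * k)))"
        using inc(2)[of i] \<tau>2[of i] that by simp
      then show ?thesis using gauss_ball_le[of "sqrt (t / (2 * k))" L] t k ab by (simp add: L_def)
    qed
    finally show ?thesis using t k by (simp add: real_sqrt_divide L_def)
  qed
  have "prob F \<le> (min 1 ((a + b) * sqrt (2 * k) / sqrt t)) ^ k"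
  proof -
    have "prob F \<le> (\<Prod>i\<in>{n..<n+k}. min 1 ((a + b) * sqrt (2 * k) / sqrt t))"
      unfolding F using each by (intro prod_mono) auto
    then show ?thesis by simp
  qed
  moreover have "prob E \<le> min 1 (2 * sqrt 2 * b / sqrt t + 3 * (t/2)\<^sup>2 / (real n * b ^ 4))"
  proof -
    define \<sigma> where "\<sigma> = sqrt (t / (2 * n))"
    have \<sigma>: "\<sigma> > 0" using t n by (simp add: \<sigma>_def)
    have "prob E \<le> 2 * b / (\<sigma> * sqrt n) + real n * (3 * \<sigma> ^ 4 / b ^ 4)"
      unfolding E_def using inc(2) \<tau>1 \<sigma> n ab
      by (intro gaussian_walk_below_le inc(1)) (auto simp: \<sigma>_def)
    also have "\<sigma> * sqrt n = sqrt (t / 2)"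
      unfolding \<sigma>_def real_sqrt_mult[symmetric] using n by simp
    also have "\<sigma> ^ 4 = (t / (2 * n))\<^sup>2"
    proof -
      have "\<sigma> ^ 4 = (\<sigma>\<^sup>2)\<^sup>2" by (simp add: power_mult[symmetric])
      then show ?thesis using t by (simp add: \<sigma>_def)
    qed
    also have "2 * b / sqrt (t / 2) = 2 * sqrt 2 * b / sqrt t"
      by (simp add: real_sqrt_divide)
    also have "real n * (3 * (t / (2 * n))\<^sup>2 / b ^ 4) = 3 * (t/2)\<^sup>2 / (real n * b ^ 4)"
      using n by (simp add: field_simps power2_eq_square)
    finally show ?thesis by simp
  qed
  moreover have "stay M Y t a b \<subseteq> E \<inter> F"
  proof
    fix \<omega> assume "\<omega> \<in> stay M Y t a b"
    then have \<omega>: "\<omega> \<in> space M" and s: "\<And>s. s \<in> {0..t} \<Longrightarrow> - a < Y s \<omega> \<and> Y s \<omega> < b"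
      using t by (auto simp: stay_eq)
    have "\<omega> \<in> E" unfolding E_def using \<omega> inc(3)[OF \<omega>] s \<tau>3 by auto
    \<comment> \<open>Both endpoints of the increment lie in a strip of width
      \<open>L\<close>.\<close>
    moreover have "\<bar>X i \<omega>\<bar> \<le> L" if "i \<in> {n..<n+k}" for i
      using s[OF \<tau>3, of i] s[OF \<tau>3, of "Suc i"] that by (auto simp: X_def L_def)
    then have "\<omega> \<in> F" unfolding F_def using \<omega> by (auto simp: abs_le_iff minus_le_iff)
    ultimately show "\<omega> \<in> E \<inter> F" ..
  qed
  then have "prob (stay M Y t a b) \<le> prob (E \<inter> F)"
    by (intro finite_measure_mono) (auto simp: E_def F_def)
  ultimately show ?thesis unfolding EF
    by (elim order_trans) (intro mult_mono, auto intro: order_trans[OF measure_nonneg])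
qed

text \<open>The staying event does not depend on the sampling, so the overshoot term of order 1 / n
  disappears in the limit.\<close>

lemma bm_strip_le:
  fixes k :: nat
  assumes t: "t > 0" and ab: "a > 0" "b > 0" and k: "k > 0"
  shows "measure M (stay M Y t a b) \<le> min 1 (2 * sqrt 2 * b / sqrt t)
     * (min 1 ((a + b) * sqrt (2 * k) / sqrt t)) ^ k"
proof -
  define R where "R = (min 1 ((a + b) * sqrt (2 * k) / sqrt t)) ^ k"
  define D where "D = 3 * (t/2)\<^sup>2 / b ^ 4"
  define x where "x = 2 * sqrt 2 * b / sqrt t"
  have "(\<lambda>n. min 1 (x + D * inverse (real n)) * R) \<longlonglongrightarrow> min 1 (x + D * 0) * R"
  proof -
    have "(\<lambda>n. D * inverse (real n)) \<longlonglongrightarrow> D * 0"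
      using lim_inverse_n by (rule tendsto_mult_left)
    then have "(\<lambda>n. x + D * inverse (real n)) \<longlonglongrightarrow> x + D * 0"
      by (rule tendsto_add[OF tendsto_const])
    then have "(\<lambda>n. min 1 (x + D * inverse (real n))) \<longlonglongrightarrow> min 1 (x + D * 0)"
      by (rule tendsto_min[OF tendsto_const])
    then show ?thesis by (rule tendsto_mult_right)
  qed
  moreover have "\<exists>N. \<forall>n\<ge>N. measure M (stay M Y t a b) \<le> min 1 (x + D * inverse (real n)) * R"
  proof (intro exI[of _ 1] allI impI)
    fix n :: nat assume "n \<ge> 1"
    then have "measure M (stay M Y t a b) \<le> min 1 (x + 3 * (t/2)\<^sup>2 / (real n * b ^ 4)) * R"
      unfolding R_def x_def by (intro bm_strip_le_aux t ab k) simp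
    also have "3 * (t/2)\<^sup>2 / (real n * b ^ 4) = D * inverse (real n)"
      by (simp only: D_def divide_inverse inverse_mult_distrib mult_ac)
    finally show "measure M (stay M Y t a b) \<le> min 1 (x + D * inverse (real n)) * R" .
  qed
  ultimately have "measure M (stay M Y t a b) \<le> min 1 (x + D * 0) * R"
    by (rule LIMSEQ_le_const)
  then show ?thesis by (simp add: R_def x_def)
qed

lemma bm_strip_ge:
  assumes t: "t > 0" and ab: "a > 0" "b > 0"
  shows "exp (- 2 * pi\<^sup>2 * t / (a + b)\<^sup>2) * sin (pi * a / (a + b)) \<le> measure M (stay M Y t a b)"
proof -
  interpret prob_space M by (rule bm_prob_space)
  note [measurable] = bm_measurable
  \<comment> \<open>Strict bounds at all dyadic times give only weak bounds on the suprema; halving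
    the barriers makes these strict for the original strip. Halving the width quadruples the decay
    rate pi^2 t / (2 (a + b)^2), whence the 2 pi^2, and leaves the argument of the sine
    unchanged.\<close>
  define E where "E m = {\<omega>\<in>space M. \<forall>k\<le>2^m. Y (t * real k / 2^m) \<omega> \<in> {-(a/2)<..<b/2}}" for m :: nat
  have [measurable]: "E m \<in> events" for m unfolding E_def by measurable
  define c where "c = exp (- 2 * pi\<^sup>2 * t / (a + b)\<^sup>2) * sin (pi * a / (a + b))"
  define d where "d = 3 * t\<^sup>2 / (a/2 + b/2) ^ 4"
  have each: "c - d * (1/2) ^ m \<le> prob (E m)" for m
  proof -
    define n :: nat where "n = 2 ^ m"
    have n: "n > 0" by (simp add: n_def)
    define \<tau> where "\<tau> i = t * real i / n" for i :: nat
    have sm: "strict_mono \<tau>" using t n by (auto intro!: strict_monoI_Suc simp: \<tau>_def divide_strict_right_mono)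
    have t0: "\<tau> 0 = 0" by (simp add: \<tau>_def)
    define X where "X i \<omega> = Y (\<tau> (Suc i)) \<omega> - Y (\<tau> i) \<omega>" for i \<omega>
    note inc = bm_increments[OF t0 sm, folded X_def]
    define \<sigma> where "\<sigma> = sqrt (t / n)"
    have \<sigma>: "\<sigma> > 0" using t n by (simp add: \<sigma>_def)
    have \<sigma>2: "\<sigma>\<^sup>2 = t / n" using t by (simp add: \<sigma>_def)
    have "\<tau> (Suc i) - \<tau> i = t / n" for i by (simp add: \<tau>_def diff_divide_distrib[symmetric] algebra_simps)
    then have law: "distr M borel (X i) = gauss \<sigma>" for i using inc(2)[of i] by (simp add: \<sigma>_def)
    have "exp (- (pi / (a/2 + b/2) * \<sigma>)\<^sup>2 * n / 2) * sin (pi * (a/2) / (a/2 + b/2)) - real n * (3 * \<sigma> ^ 4 / (a/2 + b/2) ^ 4)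
       \<le> prob {\<omega>\<in>space M. \<forall>k\<le>n. (\<Sum>i<k. X i \<omega>) \<in> {-(a/2)<..<b/2}}"
      using ab \<sigma> by (intro gaussian_walk_strip_ge inc(1) law) auto
    also have "{\<omega>\<in>space M. \<forall>k\<le>n. (\<Sum>i<k. X i \<omega>) \<in> {-(a/2)<..<b/2}} = E m"
      unfolding E_def using inc(3) by (auto simp: n_def \<tau>_def)
    also have "- (pi / (a/2 + b/2) * \<sigma>)\<^sup>2 * n / 2 = - 2 * pi\<^sup>2 * t / (a + b)\<^sup>2"
      using n ab by (simp add: power_mult_distrib \<sigma>2 power_divide add_divide_distrib[symmetric] field_simps)
    also have "pi * (a/2) / (a/2 + b/2) = pi * a / (a + b)"
      using ab by (simp add: field_simps)
    also have "real n * (3 * \<sigma> ^ 4 / (a/2 + b/2) ^ 4) = d * (1/2) ^ m"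
    proof -
      have "\<sigma> ^ 4 = (t / n)\<^sup>2" using power_mult[of \<sigma> 2 2] by (simp add: \<sigma>2)
      then have "real n * \<sigma> ^ 4 = t\<^sup>2 / n" using n by (simp add: power2_eq_square)
      then have "3 * (real n * \<sigma> ^ 4) / (a/2 + b/2) ^ 4 = 3 * (t\<^sup>2 / n) / (a/2 + b/2) ^ 4" by simp
      then have "real n * (3 * \<sigma> ^ 4 / (a/2 + b/2) ^ 4) = 3 * (t\<^sup>2 / n) / (a/2 + b/2) ^ 4" by (simp add: mult_ac)
      then show ?thesis by (simp add: d_def n_def power_one_over field_simps)
    qed
    finally show ?thesis by (simp add: c_def)
  qed
  have dec: "decseq E"
  proof (rule decseq_SucI, rule subsetI)
    fix m \<omega> assume \<omega>: "\<omega> \<in> E (Suc m)"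
    have "Y (t * real k / 2^m) \<omega> \<in> {-(a/2)<..<b/2}" if "k \<le> 2 ^ m" for k
    proof -
      have "2 * k \<le> 2 ^ Suc m" using that by simp
      then have "Y (t * real (2 * k) / 2 ^ Suc m) \<omega> \<in> {-(a/2)<..<b/2}"
        using \<omega> unfolding E_def by blast
      then show ?thesis by simp
    qed
    then show "\<omega> \<in> E m" using \<omega> by (auto simp: E_def)
  qed
  \<comment> \<open>Continuity from above along the nested dyadic events; the overshoot term is of
    order \<open>(1/2) ^ m\<close>.\<close>
  have "c - d * 0 \<le> prob (\<Inter>m. E m)"
  proof (rule LIMSEQ_le)
    show "(\<lambda>m. c - d * (1/2) ^ m) \<longlonglongrightarrow> c - d * 0"
      by (intro tendsto_intros LIMSEQ_realpow_zero) auto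
    show "(\<lambda>m. prob (E m)) \<longlonglongrightarrow> prob (\<Inter>m. E m)"
      using dec by (intro finite_Lim_measure_decseq) auto
  qed (use each in auto)
  also have "prob (\<Inter>m. E m) \<le> prob (stay M Y t a b)"
  proof (rule finite_measure_mono)
    show "stay M Y t a b \<in> events" using t by (intro stay_measurable) auto
    show "(\<Inter>m. E m) \<subseteq> stay M Y t a b"
    proof
      fix \<omega> assume \<omega>: "\<omega> \<in> (\<Inter>m. E m)"
      have g: "-(a/2) < Y s \<omega> \<and> Y s \<omega> < b/2" if "s \<in> grid t" for s
        using that \<omega> unfolding grid_def E_def by auto
      have "run_sup Y t \<omega> \<le> b/2" "run_sup (\<lambda>s \<omega>. - Y s \<omega>) t \<omega> \<le> a/2"
        unfolding run_sup_def using g by (intro cSUP_least grid_nonempty; force)+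
      then show "\<omega> \<in> stay M Y t a b" using ab \<omega> by (auto simp: stay_def E_def)
    qed
  qed
  finally show ?thesis by (simp add: c_def)
qed

text \<open>Shrink the strip to barriers \<open>min a T\<close> and \<open>T\<close>. Its width lies
  between T and 2 T, so the exponential is at least \<open>exp (- 2 * pi\<^sup>2)\<close> and the
  angle of the sine is at least \<open>min 1 (a / T)\<close>.\<close>

lemma bm_strip_ge_min:
  assumes t: "t > 0" and a: "a > 0" and b: "b \<ge> sqrt t"
  shows "exp (- 2 * pi\<^sup>2) / 3 * min 1 (a / sqrt t) \<le> measure M (stay M Y t a b)"
proof -
  interpret prob_space M by (rule bm_prob_space)
  note [measurable] = bm_measurable
  define T where "T = sqrt t"
  define a' where "a' = min a T"
  have T: "T > 0" "T\<^sup>2 = t" and a': "a' > 0" "a' \<le> T" using t a by (auto simp: T_def a'_def)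
  have "min 1 (a / T) / 2 = a' / (T + T)" using T by (auto simp: a'_def min_def field_simps)
  also have "\<dots> \<le> a' / (a' + T)" using T a' by (intro divide_left_mono) auto
  finally have r: "min 1 (a / T) / 2 \<le> a' / (a' + T)" .
  define x where "x = pi * a' / (a' + T)"
  have x: "x \<ge> 0" using a' T by (simp add: x_def)
  have "a' / (a' + T) \<le> 1 / 2" using a' T by (simp add: field_simps)
  then have "x \<le> 4 * (1 / 2)" unfolding x_def using pi_less_4 a' T
    by (subst times_divide_eq_right[symmetric], intro mult_mono) auto
  then have x2: "x \<le> 2" by simp
  \<comment> \<open>On [0, 2] one has sin x \<ge> x - x^3 / 6 \<ge> x - 4 x / 6 = x / 3, the origin
    of the factor 1 / 3.\<close>
  have "\<bar>sin x - x\<bar> \<le> x ^ 3 / 6"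
    using Maclaurin_sin_bound[of x 3] x by (simp add: sin_coeff_def eval_nat_numeral)
  moreover have "x ^ 3 \<le> 4 * x"
  proof -
    have "x * x \<le> 2 * 2" using x x2 by (intro mult_mono) auto
    then have "(x * x) * x \<le> 4 * x" using x by (intro mult_right_mono) auto
    then show ?thesis by (simp add: power3_eq_cube)
  qed
  ultimately have "x / 3 \<le> sin x" by linarith
  moreover have "min 1 (a / T) \<le> x"
  proof -
    have "2 * (min 1 (a / T) / 2) \<le> pi * (a' / (a' + T))"
      using pi_ge_two r a T by (intro mult_mono) auto
    then show ?thesis by (simp add: x_def)
  qed
  ultimately have s: "min 1 (a / T) / 3 \<le> sin x"
    by (elim order_trans[rotated]) (rule divide_right_mono, auto)
  have "T\<^sup>2 \<le> (a' + T)\<^sup>2" using a' T by (intro power_mono) auto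
  then have "t / (a' + T)\<^sup>2 \<le> 1" using a' T by (simp add: field_simps)
  then have "2 * pi\<^sup>2 * (t / (a' + T)\<^sup>2) \<le> 2 * pi\<^sup>2 * 1" by (intro mult_left_mono) auto
  then have e: "exp (- 2 * pi\<^sup>2) \<le> exp (- 2 * pi\<^sup>2 * t / (a' + T)\<^sup>2)" by simp
  have "exp (- 2 * pi\<^sup>2) * (min 1 (a / T) / 3) \<le> exp (- 2 * pi\<^sup>2 * t / (a' + T)\<^sup>2) * sin x"
    using e s a T by (intro mult_mono) auto
  also have "\<dots> \<le> prob (stay M Y t a' T)"
    unfolding x_def using t a' T by (intro bm_strip_ge) auto
  also have "\<dots> \<le> prob (stay M Y t a b)"
    using b t by (intro finite_measure_mono stay_measurable) (auto simp: stay_def a'_def T_def)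
  finally show ?thesis by (simp add: T_def)
qed

end

text \<open>Reflecting the path exchanges the barriers, so the nearer one can always be taken to be
  the upper one, which \<open>bm_strip_le\<close> singles out.\<close>

lemma brownian_motion_uminus:
  assumes "brownian_motion M Y"
  shows "brownian_motion M (\<lambda>t \<omega>. - Y t \<omega>)"
proof -
  interpret prob_space M using assms by (rule bm_prob_space)
  have d: "distributed M lborel (\<lambda>\<omega>. - Y t \<omega> - - Y s \<omega>) (\<lambda>x. ennreal (normal_density 0 (sqrt (t - s)) x))"
    if "0 \<le> s" "s < t" for s t
  proof -
    have "sqrt (t - s) > 0" using that by simp
    from normal_density_affine[OF bm_increment_law[OF assms that] this, of "-1" 0]
    have "distributed M lborel (\<lambda>\<omega>. 0 + (-1) * (Y t \<omega> - Y s \<omega>))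
        (\<lambda>x. ennreal (normal_density (0 + (-1) * 0) (\<bar>-1\<bar> * sqrt (t - s)) x))"
      by (simp only:)
    then have "distributed M lborel (\<lambda>\<omega>. 0 + (-1) * (Y t \<omega> - Y s \<omega>)) (\<lambda>x. ennreal (normal_density 0 (sqrt (t - s)) x))"
      unfolding abs_neg_one mult_1_left mult_zero_right add_0 .
    moreover have "(\<lambda>\<omega>. 0 + (-1) * (Y t \<omega> - Y s \<omega>)) = (\<lambda>\<omega>. - Y t \<omega> - - Y s \<omega>)" by (rule ext) simp
    ultimately show ?thesis by (simp only:)
  qed
  have i: "indep_vars (\<lambda>_. borel) (\<lambda>i \<omega>. - Y (\<tau> (Suc i)) \<omega> - - Y (\<tau> i) \<omega>) UNIV"
    if "0 \<le> \<tau> 0" "strict_mono \<tau>" for \<tau> :: "nat \<Rightarrow> real"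
  proof -
    have "indep_vars (\<lambda>_. borel) (\<lambda>i \<omega>. Y (\<tau> (Suc i)) \<omega> - Y (\<tau> i) \<omega>) UNIV"
      by (rule bm_increments_indep[OF assms that])
    then have "indep_vars (\<lambda>_. borel) (\<lambda>i \<omega>. - (Y (\<tau> (Suc i)) \<omega> - Y (\<tau> i) \<omega>)) UNIV"
      by (rule indep_vars_compose2[where Y="\<lambda>_ x. - x"]) simp
    moreover have "(\<lambda>i \<omega>. - (Y (\<tau> (Suc i)) \<omega> - Y (\<tau> i) \<omega>)) = (\<lambda>i \<omega>. - Y (\<tau> (Suc i)) \<omega> - - Y (\<tau> i) \<omega>)"
      by (intro ext) simp
    ultimately show ?thesis by (simp only:)
  qed
  show ?thesis
    unfolding brownian_motion_def
  proof (intro conjI allI ballI impI)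
    show "prob_space M" by unfold_locales
    show "(\<lambda>\<omega>. - Y t \<omega>) \<in> borel_measurable M" for t
      using bm_measurable[OF assms, of t] by measurable
    show "- Y 0 \<omega> = 0" "continuous_on {0..} (\<lambda>t. - Y t \<omega>)" if "\<omega> \<in> space M" for \<omega>
      using bm_zero[OF assms that] continuous_on_minus[OF bm_continuous[OF assms that]] by simp_all
  qed (use d i in blast)+
qed

lemma stay_uminus: "stay M (\<lambda>t \<omega>. - Y t \<omega>) t a b = stay M Y t b a"
  by (auto simp: stay_def)

section \<open>Truncated moments of a power tail\<close>

text \<open>The integral of \<open>x powr (r - 1)\<close> from \<open>a\<close> to \<open>b\<close>,
  with its logarithmic value at r = 0.\<close>

definition powr_shell :: "real \<Rightarrow> real \<Rightarrow> real \<Rightarrow> real" where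
  "powr_shell r a b = (if r = 0 then ln b - ln a else (b powr r - a powr r) / r)"

lemma nn_integral_powr_shell:
  assumes "0 < a" "a \<le> b"
  shows "(\<integral>\<^sup>+x. ennreal (x powr (r - 1)) * indicator {a..b} x \<partial>lborel) = ennreal (powr_shell r a b)"
proof (cases "r = 0")
  case True
  have "(\<integral>\<^sup>+x. ennreal (x powr (r - 1)) * indicator {a..b} x \<partial>lborel) = ennreal (ln b - ln a)"
  proof (rule nn_integral_FTC_Icc)
    fix x assume "x \<in> {a..b}"
    then show "DERIV ln x :> x powr (r - 1)"
      using assms True by (auto intro!: derivative_eq_intros simp: powr_minus_divide)
  qed (use assms in auto)
  then show ?thesis using True by (simp add: powr_shell_def)
next
  case False
  have "(\<integral>\<^sup>+x. ennreal (x powr (r - 1)) * indicator {a..b} x \<partial>lborel) = ennreal (b powr r / r - a powr r / r)"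
  proof (rule nn_integral_FTC_Icc)
    fix x assume "x \<in> {a..b}"
    then show "DERIV (\<lambda>x. x powr r / r) x :> x powr (r - 1)"
      using assms False by (auto intro!: derivative_eq_intros)
  qed (use assms in auto)
  then show ?thesis using False by (simp add: powr_shell_def diff_divide_distrib)
qed

lemma powr_shell_nonneg:
  assumes "0 < a" "a \<le> b"
  shows "0 \<le> powr_shell r a b"
proof (cases "r > 0")
  case True
  then show ?thesis using assms by (auto simp: powr_shell_def intro!: divide_nonneg_nonneg powr_mono2)
next
  case False
  then show ?thesis using assms powr_mono2'[of r a b] by (auto simp: powr_shell_def intro!: divide_nonpos_nonpos)
qed

lemma nn_integral_powr_tail:
  assumes "0 < a" "0 < p"
  shows "(\<integral>\<^sup>+x. ennreal (x powr (- p - 1)) * indicator {a..} x \<partial>lborel) = ennreal (a powr - p / p)"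
proof -
  have "(\<integral>\<^sup>+x. ennreal (x powr (- p - 1)) * indicator {a..} x \<partial>lborel) = ennreal (0 - (a powr - p / (- p)))"
  proof (rule nn_integral_FTC_atLeast[where F="\<lambda>x. x powr - p / (- p)" and T=0])
    fix x assume "a \<le> x"
    then show "DERIV (\<lambda>x. x powr - p / (- p)) x :> x powr (- p - 1)"
      using assms by (auto intro!: derivative_eq_intros)
  next
    show "((\<lambda>x. x powr - p / (- p)) \<longlongrightarrow> 0) at_top"
      using assms tendsto_neg_powr[of "-p" "\<lambda>x. x" at_top] 
      by (intro tendsto_divide_zero) (auto simp: filterlim_ident)
  qed (use assms in auto)
  then show ?thesis by simp
qed

text \<open>The asymptotic equivalence is frozen into bounds with constants 1/2 and 2 beyond a
  threshold. Values of \<open>\<xi>\<close> below \<open>x0\<close> enter a truncated moment only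
  through \<open>(x0 / T) ^ k\<close>; \<open>x0 \<ge> 1\<close> makes powers monotone in the
  exponent.\<close>

locale power_tail = prob_space +
  fixes \<xi> :: "'a \<Rightarrow> real" and f :: "real \<Rightarrow> real" and C p x0 :: real
  assumes pos: "\<And>\<omega>. \<omega> \<in> space M \<Longrightarrow> 0 < \<xi> \<omega>"
    and dens: "distributed M lborel \<xi> (\<lambda>x. ennreal (f x))"
    and C: "C > 0" and p: "p > 0" and x0: "x0 \<ge> 1"
    and f_bounds: "\<And>x. x0 \<le> x \<Longrightarrow> C / 2 * x powr (- p - 1) \<le> f x"
      "\<And>x. x0 \<le> x \<Longrightarrow> f x \<le> 2 * C * x powr (- p - 1)"
begin

lemma rv [measurable]: "\<xi> \<in> borel_measurable M"
  using dens by (simp add: distributed_def)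

lemma f_measurable [measurable]: "(\<lambda>x. ennreal (f x)) \<in> borel_measurable borel"
  using dens by (simp add: distributed_def)

text \<open>On the shell, density times \<open>(x / T) ^ k\<close> is comparable to
  \<open>T powr (- real k) * x powr (k - p - 1)\<close>, so the sign of k - p decides whether large
  or bounded values dominate.\<close>

lemma shell_bounds:
  fixes k :: nat
  assumes T: "x0 \<le> T"
  shows "(\<integral>\<^sup>+\<omega>. ennreal ((\<xi> \<omega> / T) ^ k) * indicator {x0..T} (\<xi> \<omega>) \<partial>M)
      \<le> ennreal (2 * C * T powr (- real k) * powr_shell (k - p) x0 T)"
    and "ennreal (C / 2 * T powr (- real k) * powr_shell (k - p) x0 T)
      \<le> (\<integral>\<^sup>+\<omega>. ennreal ((\<xi> \<omega> / T) ^ k) * indicator {x0..T} (\<xi> \<omega>) \<partial>M)"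
proof -
  have T0: "T > 0" using T x0 by simp
  have sc: "(\<integral>\<^sup>+x. ennreal (c * T powr (- real k)) * (ennreal (x powr (k - p - 1)) * indicator {x0..T} x) \<partial>lborel)
     = ennreal (c * T powr (- real k) * powr_shell (k - p) x0 T)" if "c \<ge> 0" for c
    using x0 T that by (simp add: nn_integral_cmult nn_integral_powr_shell ennreal_mult' [symmetric] powr_shell_nonneg)
  have pt: "c * x powr (- p - 1) * (x / T) ^ k = c * T powr (- real k) * x powr (k - p - 1)" if "x > 0" for c x
  proof -
    have "(x / T) ^ k = x powr real k * T powr (- real k)"
      using that T0 by (simp add: power_divide powr_minus_divide powr_realpow)
    moreover have "x powr (- p - 1) * x powr real k = x powr (k - p - 1)"
      by (simp add: powr_add[symmetric] algebra_simps)
    ultimately show ?thesis by (simp add: mult_ac)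
  qed
  have e: "(\<integral>\<^sup>+\<omega>. ennreal ((\<xi> \<omega> / T) ^ k) * indicator {x0..T} (\<xi> \<omega>) \<partial>M)
      = (\<integral>\<^sup>+x. ennreal (f x) * (ennreal ((x / T) ^ k) * indicator {x0..T} x) \<partial>lborel)"
    by (rule distributed_nn_integral[OF dens, symmetric]) measurable
  also have "\<dots> \<le> (\<integral>\<^sup>+x. ennreal (2 * C * T powr (- real k)) * (ennreal (x powr (k - p - 1)) * indicator {x0..T} x) \<partial>lborel)"
  proof (rule nn_integral_mono)
    fix x
    show "ennreal (f x) * (ennreal ((x / T) ^ k) * indicator {x0..T} x)
       \<le> ennreal (2 * C * T powr (- real k)) * (ennreal (x powr (k - p - 1)) * indicator {x0..T} x)"
    proof (cases "x \<in> {x0..T}")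
      case True
      have "f x * (x / T) ^ k \<le> 2 * C * x powr (- p - 1) * (x / T) ^ k"
        using f_bounds(2)[of x] T0 x0 True by (intro mult_right_mono) auto
      also have "\<dots> = 2 * C * T powr (- real k) * x powr (k - p - 1)"
        using True x0 by (intro pt) auto
      finally have "f x * (x / T) ^ k \<le> 2 * C * T powr (- real k) * x powr (k - p - 1)" .
      then show ?thesis using True x0 C T0
        by (simp add: ennreal_mult''[symmetric] ennreal_leI)
    qed auto
  qed
  also have "\<dots> = ennreal (2 * C * T powr (- real k) * powr_shell (k - p) x0 T)"
    using C by (intro sc) auto
  finally show "(\<integral>\<^sup>+\<omega>. ennreal ((\<xi> \<omega> / T) ^ k) * indicator {x0..T} (\<xi> \<omega>) \<partial>M)
      \<le> ennreal (2 * C * T powr (- real k) * powr_shell (k - p) x0 T)" .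
  have "ennreal (C / 2 * T powr (- real k) * powr_shell (k - p) x0 T) =
     (\<integral>\<^sup>+x. ennreal (C / 2 * T powr (- real k)) * (ennreal (x powr (k - p - 1)) * indicator {x0..T} x) \<partial>lborel)"
    using C by (intro sc[symmetric]) auto
  also have "\<dots> \<le> (\<integral>\<^sup>+x. ennreal (f x) * (ennreal ((x / T) ^ k) * indicator {x0..T} x) \<partial>lborel)"
  proof (rule nn_integral_mono)
    fix x
    show "ennreal (C / 2 * T powr (- real k)) * (ennreal (x powr (k - p - 1)) * indicator {x0..T} x)
       \<le> ennreal (f x) * (ennreal ((x / T) ^ k) * indicator {x0..T} x)"
    proof (cases "x \<in> {x0..T}")
      case True
      then have "C / 2 * x powr (- p - 1) * (x / T) ^ k \<le> f x * (x / T) ^ k"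
        using f_bounds(1)[of x] T0 x0 by (intro mult_right_mono) auto
      moreover have "C / 2 * x powr (- p - 1) * (x / T) ^ k = C / 2 * T powr (- real k) * x powr (k - p - 1)"
        using True x0 by (intro pt) auto
      ultimately have "C / 2 * T powr (- real k) * x powr (k - p - 1) \<le> f x * (x / T) ^ k" by linarith
      then show ?thesis using True x0 C T0
        by (simp add: ennreal_mult''[symmetric] ennreal_leI)
    qed auto
  qed
  finally show "ennreal (C / 2 * T powr (- real k) * powr_shell (k - p) x0 T)
      \<le> (\<integral>\<^sup>+\<omega>. ennreal ((\<xi> \<omega> / T) ^ k) * indicator {x0..T} (\<xi> \<omega>) \<partial>M)"
    unfolding e .
qed

lemma tail_bounds:
  assumes T: "x0 \<le> T"
  shows "prob {\<omega>\<in>space M. T \<le> \<xi> \<omega>} \<le> 2 * C / p * T powr - p"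
    and "C / (2 * p) * T powr - p \<le> prob {\<omega>\<in>space M. T \<le> \<xi> \<omega>}"
proof -
  have T0: "T > 0" using T x0 by simp
  have sc: "(\<integral>\<^sup>+x. ennreal c * (ennreal (x powr (- p - 1)) * indicator {T..} x) \<partial>lborel)
     = ennreal (c / p * T powr - p)" if "c \<ge> 0" for c
    using T0 p that by (simp add: nn_integral_cmult nn_integral_powr_tail ennreal_mult' [symmetric])
  have "emeasure M {\<omega>\<in>space M. T \<le> \<xi> \<omega>} = (\<integral>\<^sup>+\<omega>. indicator {T..} (\<xi> \<omega>) \<partial>M)"
  proof -
    have "emeasure M {\<omega>\<in>space M. T \<le> \<xi> \<omega>} = (\<integral>\<^sup>+\<omega>. indicator {\<omega>\<in>space M. T \<le> \<xi> \<omega>} \<omega> \<partial>M)"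
      by (rule nn_integral_indicator[symmetric]) measurable
    also have "\<dots> = (\<integral>\<^sup>+\<omega>. indicator {T..} (\<xi> \<omega>) \<partial>M)"
      by (intro nn_integral_cong) (auto simp: indicator_def)
    finally show ?thesis .
  qed
  also have e: "(\<integral>\<^sup>+\<omega>. indicator {T..} (\<xi> \<omega>) \<partial>M) = (\<integral>\<^sup>+x. ennreal (f x) * indicator {T..} x \<partial>lborel)"
    by (rule distributed_nn_integral[OF dens, symmetric]) measurable
  finally have em: "ennreal (prob {\<omega>\<in>space M. T \<le> \<xi> \<omega>}) = (\<integral>\<^sup>+x. ennreal (f x) * indicator {T..} x \<partial>lborel)"
    by (simp add: emeasure_eq_measure)
  also have "\<dots> \<le> (\<integral>\<^sup>+x. ennreal (2 * C) * (ennreal (x powr (- p - 1)) * indicator {T..} x) \<partial>lborel)"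
    using f_bounds(2) T C
    by (intro nn_integral_mono) (auto simp: indicator_def ennreal_mult'[symmetric] intro!: ennreal_leI)
  also have "\<dots> = ennreal (2 * C / p * T powr - p)" using C by (intro sc) auto
  finally show "prob {\<omega>\<in>space M. T \<le> \<xi> \<omega>} \<le> 2 * C / p * T powr - p"
    using C p by (subst (asm) ennreal_le_iff) auto
  have "ennreal (C / 2 / p * T powr - p) = (\<integral>\<^sup>+x. ennreal (C / 2) * (ennreal (x powr (- p - 1)) * indicator {T..} x) \<partial>lborel)"
    using C by (intro sc[symmetric]) auto
  also have "\<dots> \<le> (\<integral>\<^sup>+x. ennreal (f x) * indicator {T..} x \<partial>lborel)"
    using f_bounds(1) T C
    by (intro nn_integral_mono) (auto simp: indicator_def ennreal_mult'[symmetric] intro!: ennreal_leI)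
  finally show "C / (2 * p) * T powr - p \<le> prob {\<omega>\<in>space M. T \<le> \<xi> \<omega>}"
    unfolding em[symmetric] by (simp add: ennreal_le_iff)
qed

definition trunc_moment :: "nat \<Rightarrow> real \<Rightarrow> real" where
  "trunc_moment k T = expectation (\<lambda>\<omega>. min 1 (\<xi> \<omega> / T) ^ k)"

lemma integrable_trunc: "T > 0 \<Longrightarrow> integrable M (\<lambda>\<omega>. min 1 (\<xi> \<omega> / T) ^ k)"
  using pos by (intro integrable_const_bound[where B=1])
    (auto intro!: AE_I2 power_le_one simp: less_imp_le)

lemma trunc_moment_eq_nn: "T > 0 \<Longrightarrow> ennreal (trunc_moment k T) = (\<integral>\<^sup>+\<omega>. ennreal (min 1 (\<xi> \<omega> / T) ^ k) \<partial>M)"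
  unfolding trunc_moment_def using pos
  by (intro nn_integral_eq_integral[symmetric] integrable_trunc) (auto intro!: AE_I2 simp: less_imp_le)

lemma trunc_moment_nonneg: "T > 0 \<Longrightarrow> 0 \<le> trunc_moment k T"
  unfolding trunc_moment_def using pos by (intro integral_nonneg_AE AE_I2) (auto simp: less_imp_le)

lemma trunc_moment_le_1: "T > 0 \<Longrightarrow> trunc_moment k T \<le> 1"
  unfolding trunc_moment_def using pos integrable_trunc
  by (intro integral_le_const AE_I2) (auto intro!: power_le_one simp: less_imp_le)

text \<open>One term each for values below \<open>x0\<close>, in the shell, and beyond T. The ranges
  share endpoints, which is harmless for an upper bound.\<close>

lemma trunc_moment_le:
  fixes k :: nat
  assumes T: "x0 \<le> T"
  shows "trunc_moment k T \<le> (x0 / T) ^ k + 2 * C * T powr (- real k) * powr_shell (k - p) x0 T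
    + 2 * C / p * T powr - p"
proof -
  have T0: "T > 0" using T x0 by simp
  have "ennreal (trunc_moment k T) \<le> (\<integral>\<^sup>+\<omega>. ennreal ((x0 / T) ^ k)
     + ennreal ((\<xi> \<omega> / T) ^ k) * indicator {x0..T} (\<xi> \<omega>) + indicator {\<omega>\<in>space M. T \<le> \<xi> \<omega>} \<omega> \<partial>M)"
    unfolding trunc_moment_eq_nn[OF T0]
  proof (rule nn_integral_mono)
    fix \<omega> assume \<omega>: "\<omega> \<in> space M"
    consider "\<xi> \<omega> \<le> x0" | "x0 \<le> \<xi> \<omega>" "\<xi> \<omega> \<le> T" | "T \<le> \<xi> \<omega>" by linarith
    then show "ennreal (min 1 (\<xi> \<omega> / T) ^ k) \<le> ennreal ((x0 / T) ^ k)
     + ennreal ((\<xi> \<omega> / T) ^ k) * indicator {x0..T} (\<xi> \<omega>) + indicator {\<omega>\<in>space M. T \<le> \<xi> \<omega>} \<omega>"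
    proof cases
      case 1
      then have "min 1 (\<xi> \<omega> / T) ^ k \<le> (x0 / T) ^ k"
        using pos[OF \<omega>] T0 by (intro power_mono) (auto simp: min_le_iff_disj divide_right_mono)
      then have "ennreal (min 1 (\<xi> \<omega> / T) ^ k) \<le> ennreal ((x0 / T) ^ k)" by (rule ennreal_leI)
      then show ?thesis by (simp add: add_increasing2 add.assoc)
    next
      case 2
      have "min 1 (\<xi> \<omega> / T) ^ k \<le> (\<xi> \<omega> / T) ^ k"
        using pos[OF \<omega>] T0 by (intro power_mono) auto
      then have "ennreal (min 1 (\<xi> \<omega> / T) ^ k) \<le> ennreal ((\<xi> \<omega> / T) ^ k)" by (rule ennreal_leI)
      then show ?thesis using 2 by (simp add: add_increasing add_increasing2)
    next
      case 3
      have "min 1 (\<xi> \<omega> / T) ^ k \<le> 1"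
        using pos[OF \<omega>] T0 by (intro power_le_one) auto
      then have "ennreal (min 1 (\<xi> \<omega> / T) ^ k) \<le> ennreal 1" by (rule ennreal_leI)
      then show ?thesis using 3 \<omega> by (simp add: add_increasing)
    qed
  qed
  also have "\<dots> = ennreal ((x0 / T) ^ k) + (\<integral>\<^sup>+\<omega>. ennreal ((\<xi> \<omega> / T) ^ k) * indicator {x0..T} (\<xi> \<omega>) \<partial>M)
     + ennreal (prob {\<omega>\<in>space M. T \<le> \<xi> \<omega>})"
    by (simp add: nn_integral_add emeasure_space_1 emeasure_eq_measure prob_space)
  also have "\<dots> \<le> ennreal ((x0 / T) ^ k) + ennreal (2 * C * T powr (- real k) * powr_shell (k - p) x0 T)
     + ennreal (2 * C / p * T powr - p)"
    by (intro add_mono shell_bounds T ennreal_leI tail_bounds order_refl)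
  also have "\<dots> = ennreal ((x0 / T) ^ k + 2 * C * T powr (- real k) * powr_shell (k - p) x0 T
    + 2 * C / p * T powr - p)"
    using x0 T C p powr_shell_nonneg[of x0 T "k - p"] by (simp add: ennreal_plus[symmetric] del: ennreal_plus)
  finally show ?thesis
    using x0 T C p powr_shell_nonneg[of x0 T "k - p"] by (subst (asm) ennreal_le_iff) auto
qed

lemma trunc_moment_ge:
  assumes T: "x0 \<le> T"
  shows "C / 2 * T powr - 1 * powr_shell (1 - p) x0 T \<le> trunc_moment 1 T"
proof -
  have T0: "T > 0" using T x0 by simp
  have "ennreal (C / 2 * T powr (- real 1) * powr_shell (real 1 - p) x0 T)
     \<le> (\<integral>\<^sup>+\<omega>. ennreal ((\<xi> \<omega> / T) ^ 1) * indicator {x0..T} (\<xi> \<omega>) \<partial>M)"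
    by (rule shell_bounds(2)[OF T])
  also have "\<dots> \<le> (\<integral>\<^sup>+\<omega>. ennreal (min 1 (\<xi> \<omega> / T) ^ 1) \<partial>M)"
    using T0 by (intro nn_integral_mono) (auto simp: indicator_def)
  also have "\<dots> = ennreal (trunc_moment 1 T)"
    by (rule trunc_moment_eq_nn[OF T0, symmetric])
  finally show ?thesis using trunc_moment_nonneg[OF T0, of 1] by (simp add: ennreal_le_iff)
qed

text \<open>The integrand is 1 on the tail event. For p < 1 this already gives a lower bound of the
  correct order.\<close>

lemma tail_le_trunc_moment:
  assumes "T > 0"
  shows "prob {\<omega>\<in>space M. T \<le> \<xi> \<omega>} \<le> trunc_moment k T"
proof -
  have "prob {\<omega>\<in>space M. T \<le> \<xi> \<omega>} = expectation (indicator {\<omega>\<in>space M. T \<le> \<xi> \<omega>})"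
    by (simp add: Int_def conj_commute cong: conj_cong)
  also have "\<dots> \<le> trunc_moment k T"
    unfolding trunc_moment_def
  proof (rule integral_mono)
    show "integrable M (indicator {\<omega>\<in>space M. T \<le> \<xi> \<omega>} :: _ \<Rightarrow> real)"
      by (rule integrable_const_bound[where B=1]) auto
    fix \<omega> assume \<omega>: "\<omega> \<in> space M"
    show "indicator {\<omega>\<in>space M. T \<le> \<xi> \<omega>} \<omega> \<le> min 1 (\<xi> \<omega> / T) ^ k"
      using pos[OF \<omega>] assms by (auto simp: indicator_def min_def field_simps)
  qed (rule integrable_trunc[OF assms])
  finally show ?thesis .
qed

text \<open>When k exceeds p, the shell integral is dominated by its upper end, where it has the
  size of the tail probability, and the contribution from below \<open>x0\<close> is smaller still.
  Besides large k, the case k = 1 > p settles the first moment.\<close>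

lemma trunc_moment_high_le:
  fixes k :: nat
  assumes k: "p < k" and T: "x0 \<le> T"
  shows "trunc_moment k T \<le> (x0 ^ k + 2 * C / (k - p) + 2 * C / p) * T powr - p"
proof -
  have T0: "T \<ge> 1" using T x0 by simp
  have Tk: "T powr - real k \<le> T powr - p" using k T0 by (intro powr_mono) auto
  have 1: "(x0 / T) ^ k \<le> x0 ^ k * T powr - p"
  proof -
    have "(x0 / T) ^ k = x0 ^ k * T powr - real k"
      using T0 by (simp add: power_divide powr_minus_divide powr_realpow)
    then show ?thesis using Tk x0 by (simp add: mult_left_mono)
  qed
  have "T powr (- real k) * powr_shell (k - p) x0 T \<le> T powr (- real k) * (T powr (k - p) / (k - p))"
    using k by (intro mult_left_mono) (auto simp: powr_shell_def divide_right_mono)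
  also have "\<dots> = T powr - p / (k - p)" by (simp add: powr_add[symmetric])
  finally have "2 * C * (T powr (- real k) * powr_shell (k - p) x0 T) \<le> 2 * C * (T powr - p / (k - p))"
    using C by (intro mult_left_mono) auto
  then show ?thesis using trunc_moment_le[OF T, of k] 1 by (simp add: algebra_simps)
qed

end

section \<open>The three regimes of the truncated first moment\<close>

definition first_moment_rate :: "real \<Rightarrow> real \<Rightarrow> real" where
  "first_moment_rate p T = (if p < 1 then T powr - p else if p = 1 then T powr - 1 * ln T else T powr - 1)"

text \<open>The first moment up to T integrates \<open>x powr - p\<close>: for p < 1 values near T
  dominate, for p = 1 every scale contributes equally and produces the logarithm, and for p > 1 the
  integral stays bounded, leaving only the factor 1 / T.\<close>

lemma (in power_tail) first_moment_bounds:
  "\<exists>c1>0. \<exists>c2>0. \<forall>\<^sub>F T in at_top. c1 * first_moment_rate p T \<le> trunc_moment 1 T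
     \<and> trunc_moment 1 T \<le> c2 * first_moment_rate p T"
proof -
  have ge: "\<forall>\<^sub>F T in at_top. T \<ge> c" for c :: real by (rule eventually_ge_at_top)
  consider "p < 1" | "p = 1" | "p > 1" by linarith
  then show ?thesis
  proof cases
    case 1
    define c2 where "c2 = x0 + 2 * C / (1 - p) + 2 * C / p"
    have "C / (2 * p) * first_moment_rate p T \<le> trunc_moment 1 T \<and> trunc_moment 1 T \<le> c2 * first_moment_rate p T"
      if T: "x0 \<le> T" for T
    proof
      have "T > 0" using T x0 by simp
      from order_trans[OF tail_bounds(2)[OF T] tail_le_trunc_moment[OF this]]
      show "C / (2 * p) * first_moment_rate p T \<le> trunc_moment 1 T" using 1 by (simp add: first_moment_rate_def)
      show "trunc_moment 1 T \<le> c2 * first_moment_rate p T"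
        using trunc_moment_high_le[of 1 T] T 1 by (simp add: first_moment_rate_def c2_def)
    qed
    then have "\<forall>\<^sub>F T in at_top. C / (2 * p) * first_moment_rate p T \<le> trunc_moment 1 T
        \<and> trunc_moment 1 T \<le> c2 * first_moment_rate p T"
      using ge[of x0] by (rule eventually_mono[rotated])
    moreover have "C / (2 * p) > 0" "c2 > 0" using C p x0 1 by (auto simp: c2_def intro!: add_pos_nonneg)
    ultimately show ?thesis by blast
  next
    case 2
    define c2 where "c2 = x0 + 4 * C"
    \<comment> \<open>T \<ge> x0^2 keeps at least half of the logarithm after subtracting
      \<open>ln x0\<close>, and T \<ge> e lets \<open>ln T\<close> absorb constants. In
      \<open>c2\<close>, shell and tail contribute 2 C each.\<close>
    have "C / 4 * first_moment_rate p T \<le> trunc_moment 1 T \<and> trunc_moment 1 T \<le> c2 * first_moment_rate p T"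
      if T: "max (x0\<^sup>2) (exp 1) \<le> T" for T
    proof
      have x02: "x0 \<le> x0\<^sup>2" using x0 by (simp add: power2_eq_square)
      have Tx: "x0 \<le> T" using T x02 by simp
      have T0: "T > 0" using Tx x0 by simp
      have l1: "1 \<le> ln T" using T T0 by (simp add: ln_ge_iff)
      have "ln (x0\<^sup>2) \<le> ln T" using T T0 x0 by (intro ln_le_cancel_iff[THEN iffD2]) auto
      then have l2: "2 * ln x0 \<le> ln T" using x0 by (simp add: ln_realpow)
      have "C / 4 * (T powr - 1 * ln T) = C / 2 * T powr - 1 * (ln T / 2)" by simp
      also have "\<dots> \<le> C / 2 * T powr - 1 * (ln T - ln x0)"
        using l2 C by (intro mult_left_mono) auto
      also have "\<dots> \<le> trunc_moment 1 T"
        using trunc_moment_ge[OF Tx] 2 by (simp add: powr_shell_def)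
      finally show "C / 4 * first_moment_rate p T \<le> trunc_moment 1 T" using 2 by (simp add: first_moment_rate_def)
      have "trunc_moment 1 T \<le> x0 / T + 2 * C * T powr - 1 * (ln T - ln x0) + 2 * C * T powr - 1"
        using trunc_moment_le[OF Tx, of 1] 2 by (simp add: powr_shell_def)
      also have "x0 / T = x0 * T powr - 1" using T0 by (simp add: powr_minus divide_inverse)
      also have "x0 * T powr - 1 + 2 * C * T powr - 1 * (ln T - ln x0) + 2 * C * T powr - 1
         = T powr - 1 * (x0 + 2 * C * (ln T - ln x0) + 2 * C)"
      proof -
        have "x0 * e + 2 * C * e * l + 2 * C * e = e * (x0 + 2 * C * l + 2 * C)" for e l :: real
          by (simp add: algebra_simps)
        then show ?thesis .
      qed
      also have "\<dots> \<le> T powr - 1 * (c2 * ln T)"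
      proof (rule mult_left_mono)
        have "0 \<le> C * ln x0" using C x0 by simp
        moreover have "x0 * 1 \<le> x0 * ln T" "C * 1 \<le> C * ln T" using l1 x0 C by (auto intro!: mult_left_mono)
        ultimately show "x0 + 2 * C * (ln T - ln x0) + 2 * C \<le> c2 * ln T" by (simp add: c2_def algebra_simps)
      qed simp
      finally show "trunc_moment 1 T \<le> c2 * first_moment_rate p T" using 2 by (simp add: first_moment_rate_def mult_ac)
    qed
    then have "\<forall>\<^sub>F T in at_top. C / 4 * first_moment_rate p T \<le> trunc_moment 1 T
        \<and> trunc_moment 1 T \<le> c2 * first_moment_rate p T"
      using ge[of "max (x0\<^sup>2) (exp 1)"] by (rule eventually_mono[rotated])
    moreover have "C / 4 > 0" "c2 > 0" using C x0 by (auto simp: c2_def intro!: add_pos_nonneg)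
    ultimately show ?thesis by blast
  next
    case 3
    define c2 where "c2 = x0 + 2 * C / (p - 1) + 2 * C / p"
    \<comment> \<open>The contribution of the shell from \<open>x0\<close> to \<open>2 * x0\<close>
      alone, which is positive and independent of T.\<close>
    define c1 where "c1 = C / 2 * ((x0 powr (1 - p) - (2 * x0) powr (1 - p)) / (p - 1))"
    have "c1 * first_moment_rate p T \<le> trunc_moment 1 T \<and> trunc_moment 1 T \<le> c2 * first_moment_rate p T"
      if T: "2 * x0 \<le> T" for T
    proof
      have Tx: "x0 \<le> T" using T x0 by simp
      have T0: "T > 0" using Tx x0 by simp
      have sh: "powr_shell (1 - p) x0 T = (x0 powr (1 - p) - T powr (1 - p)) / (p - 1)"
      proof -
        have "(T powr (1 - p) - x0 powr (1 - p)) / (1 - p) = (- (x0 powr (1 - p) - T powr (1 - p))) / (- (p - 1))"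
          by simp
        then show ?thesis using 3 unfolding powr_shell_def minus_divide_divide by simp
      qed
      have "T powr (1 - p) \<le> (2 * x0) powr (1 - p)" using T x0 3 by (intro powr_mono2') auto
      then have "(x0 powr (1 - p) - (2 * x0) powr (1 - p)) / (p - 1) \<le> powr_shell (1 - p) x0 T"
        unfolding sh using 3 by (intro divide_right_mono) auto
      then have "C / 2 * T powr - 1 * ((x0 powr (1 - p) - (2 * x0) powr (1 - p)) / (p - 1)) \<le> C / 2 * T powr - 1 * powr_shell (1 - p) x0 T"
        using C by (intro mult_left_mono) auto
      also have "\<dots> \<le> trunc_moment 1 T" by (rule trunc_moment_ge[OF Tx])
      finally show "c1 * first_moment_rate p T \<le> trunc_moment 1 T" using 3 by (simp add: first_moment_rate_def c1_def mult_ac)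
      have "x0 powr (1 - p) \<le> x0 powr 0" using x0 3 by (intro powr_mono) auto
      then have "x0 powr (1 - p) \<le> 1" using x0 by simp
      moreover have "0 \<le> T powr (1 - p)" by simp
      ultimately have "x0 powr (1 - p) - T powr (1 - p) \<le> 1" by linarith
      then have "powr_shell (1 - p) x0 T \<le> 1 / (p - 1)"
        unfolding sh using 3 by (intro divide_right_mono) auto
      then have "2 * C * T powr - 1 * powr_shell (1 - p) x0 T \<le> 2 * C * T powr - 1 * (1 / (p - 1))"
        using C by (intro mult_left_mono) auto
      moreover have "2 * C / p * T powr - p \<le> 2 * C / p * T powr - 1"
        using C p T0 Tx x0 3 by (intro mult_left_mono powr_mono) auto
      moreover have "x0 / T = x0 * T powr - 1" using T0 by (simp add: powr_minus divide_inverse)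
      moreover have tm: "trunc_moment 1 T \<le> x0 / T + 2 * C * T powr - 1 * powr_shell (1 - p) x0 T + 2 * C / p * T powr - p"
        using trunc_moment_le[OF Tx, of 1] by (simp only: of_nat_1 power_one_right)
      ultimately have "trunc_moment 1 T \<le> x0 * T powr - 1 + 2 * C * T powr - 1 * (1 / (p - 1)) + 2 * C / p * T powr - 1"
        using tm by linarith
      also have "\<dots> = c2 * T powr - 1" by (simp add: c2_def algebra_simps)
      finally show "trunc_moment 1 T \<le> c2 * first_moment_rate p T" using 3 by (simp add: first_moment_rate_def)
    qed
    then have "\<forall>\<^sub>F T in at_top. c1 * first_moment_rate p T \<le> trunc_moment 1 T
        \<and> trunc_moment 1 T \<le> c2 * first_moment_rate p T"
      using ge[of "2 * x0"] by (rule eventually_mono[rotated])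
    moreover have "c2 > 0" using C x0 3 by (auto simp: c2_def intro!: add_pos_nonneg)
    moreover have "(2 * x0) powr (1 - p) < x0 powr (1 - p)" using x0 3 by (intro powr_less_mono2_neg) auto
    then have "c1 > 0" using C 3 by (auto simp: c1_def intro!: mult_pos_pos divide_pos_pos)
    ultimately show ?thesis by blast
  qed
qed

lemma power_tail_bounds:
  fixes f :: "real \<Rightarrow> real"
  assumes "C > 0" and tail: "f \<sim>[at_top] (\<lambda>t. C * t powr (- p - 1))"
  shows "\<exists>x0\<ge>1. \<forall>x\<ge>x0. C / 2 * x powr (- p - 1) \<le> f x \<and> f x \<le> 2 * C * x powr (- p - 1)"
proof -
  let ?g = "\<lambda>t. C * t powr (- p - 1)"
  have lim: "((\<lambda>x. if f x = 0 \<and> ?g x = 0 then 1 else f x / ?g x) \<longlongrightarrow> 1) at_top"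
    by (rule asymp_equivD[OF tail])
  have "\<forall>\<^sub>F x in at_top. 1/2 < (if f x = 0 \<and> ?g x = 0 then 1 else f x / ?g x)"
    "\<forall>\<^sub>F x in at_top. (if f x = 0 \<and> ?g x = 0 then 1 else f x / ?g x) < 2"
    by (rule order_tendstoD[OF lim], simp)+
  moreover have "\<forall>\<^sub>F x::real in at_top. x > 0" by (rule eventually_gt_at_top)
  ultimately have "\<forall>\<^sub>F x in at_top. ?g x / 2 \<le> f x \<and> f x \<le> 2 * ?g x"
  proof eventually_elim
    case (elim x)
    have g: "?g x > 0" using elim assms by simp
    then have "1/2 < f x / ?g x" "f x / ?g x < 2" using elim by (auto split: if_splits)
    then show ?case using g by (simp only: pos_less_divide_eq pos_divide_less_eq) linarith
  qed
  then obtain N where N: "\<And>x. x \<ge> N \<Longrightarrow> ?g x / 2 \<le> f x \<and> f x \<le> 2 * ?g x"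
    by (auto simp: eventually_at_top_linorder)
  have "C / 2 * x powr (- p - 1) \<le> f x \<and> f x \<le> 2 * C * x powr (- p - 1)" if "x \<ge> max 1 N" for x
    using N[of x] that by (simp only: mult.assoc times_divide_eq_left)
  then show ?thesis by (intro exI[of _ "max 1 N"]) simp
qed

section \<open>Random strips and exit times\<close>

text \<open>Presents \<open>gen_sigma\<close> as the sets of a measure, so that measurability rules
  show the running suprema to depend on the path alone.\<close>

lemma sets_sigma_gen:
  "sets (sigma (space M) (\<Union>i. {X i -` A \<inter> space M | A. A \<in> sets borel})) = gen_sigma M X"
  unfolding gen_sigma_def by (intro sets_measure_of) auto

lemma measurable_sigma_gen:
  fixes X :: "'i \<Rightarrow> 'a \<Rightarrow> real"
  shows "X i \<in> borel_measurable (sigma (space M) (\<Union>i. {X i -` A \<inter> space M | A. A \<in> sets borel}))"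
  (is "_ \<in> borel_measurable ?N")
proof (rule measurableI)
  fix A :: "real set" assume "A \<in> sets borel"
  moreover have "space ?N = space M" by (intro space_measure_of) auto
  ultimately show "X i -` A \<inter> space ?N \<in> sets ?N"
    unfolding sets_sigma_gen gen_sigma_def by (auto intro!: sigma_sets.Basic)
qed auto

lemma vimage_subset_gen_sigma:
  assumes "Z \<in> borel_measurable (sigma (space M) (\<Union>i. {X i -` A \<inter> space M | A. A \<in> sets borel}))"
  shows "{Z -` A \<inter> space M | A. A \<in> sets borel} \<subseteq> gen_sigma M X"
proof -
  have "space (sigma (space M) (\<Union>i. {X i -` A \<inter> space M | A. A \<in> sets borel})) = space M"
    by (intro space_measure_of) auto
  then show ?thesis using measurable_sets[OF assms] by (auto simp: sets_sigma_gen)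
qed

section \<open>Barriers that are random and independent of the path\<close>

locale random_strip =
  fixes M :: "'a measure" and Y :: "real \<Rightarrow> 'a \<Rightarrow> real"
    and \<xi>1 \<xi>2 :: "'a \<Rightarrow> real" and f :: "real \<Rightarrow> real" and C p x0 :: real
  assumes BM: "brownian_motion M Y"
    and tail1: "power_tail M \<xi>1 f C p x0" and tail2: "power_tail M \<xi>2 f C p x0"
    and indep: "prob_space.indep_sets M
       (\<lambda>i::nat. if i = 0 then gen_sigma M (\<lambda>_::unit. \<xi>1)
                 else if i = 1 then gen_sigma M (\<lambda>_::unit. \<xi>2)
                 else gen_sigma M Y) {0, 1, 2}"
begin

sublocale P1: power_tail M \<xi>1 f C p x0 by (rule tail1)
sublocale P2: power_tail M \<xi>2 f C p x0 by (rule tail2)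

definition rstay :: "real \<Rightarrow> 'a set" where
  "rstay t = {\<omega>\<in>space M. \<omega> \<in> stay M Y t (\<xi>1 \<omega>) (\<xi>2 \<omega>)}"

text \<open>The outer \<omega> fixes only the barriers; the path inside \<open>measure\<close> is
  averaged anew. In \<open>rstay\<close>, barriers and path share the same \<omega>.\<close>

definition strip_prob :: "real \<Rightarrow> 'a \<Rightarrow> real" where
  "strip_prob t \<omega> = measure M (stay M Y t (\<xi>1 \<omega>) (\<xi>2 \<omega>))"

lemma rstay_eq:
  assumes "t \<ge> 0"
  shows "rstay t = {\<omega>\<in>space M. \<forall>s\<in>{0..t}. - \<xi>1 \<omega> < Y s \<omega> \<and> Y s \<omega> < \<xi>2 \<omega>}"
  unfolding rstay_def stay_eq[OF BM assms] by auto

text \<open>The running suprema are measurable for the sigma-algebra of the path, so independence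
  passes to them. Barriers are padded with 0 because a family of random variables needs one common
  value type.\<close>

lemma indep_triple:
  assumes "t \<ge> 0"
  defines "Z \<equiv> (\<lambda>i::nat. if i = 0 then \<lambda>\<omega>. (\<xi>1 \<omega>, 0) else if i = 1 then \<lambda>\<omega>. (\<xi>2 \<omega>, 0)
     else (\<lambda>\<omega>. (run_sup (\<lambda>s \<omega>. - Y s \<omega>) t \<omega>, run_sup Y t \<omega>)))"
  shows "P1.indep_vars (\<lambda>_. borel :: (real \<times> real) measure) Z {0, 1, 2}"
  unfolding P1.indep_vars_def2
proof
  let ?N = "sigma (space M) (\<Union>i. {Y i -` A \<inter> space M | A. A \<in> sets borel})"
  have sp: "space ?N = space M" by (intro space_measure_of) auto
  have r: "run_sup Y t \<in> borel_measurable ?N" "run_sup (\<lambda>s \<omega>. - Y s \<omega>) t \<in> borel_measurable ?N"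
    using assms(1) bm_continuous[OF BM] measurable_sigma_gen[of Y _ M]
    by (auto intro!: run_sup_measurable continuous_on_minus borel_measurable_uminus simp: sp)
  have r': "run_sup Y t \<in> borel_measurable M" "run_sup (\<lambda>s \<omega>. - Y s \<omega>) t \<in> borel_measurable M"
    using assms(1) bm_continuous[OF BM] bm_measurable[OF BM]
    by (auto intro!: run_sup_measurable continuous_on_minus borel_measurable_uminus)
  show "\<forall>i\<in>{0, 1, 2}. P1.random_variable borel (Z i)"
    using r' P1.rv P2.rv by (auto simp: Z_def intro!: borel_measurable_Pair)
  have "{Z i -` A \<inter> space M | A. A \<in> sets borel} \<subseteq> gen_sigma M (\<lambda>_::unit. \<xi>1)" if "i = 0" for i
    unfolding Z_def using that measurable_sigma_gen[of "\<lambda>_::unit. \<xi>1" "()" M]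
    by (intro vimage_subset_gen_sigma) (auto intro!: borel_measurable_Pair)
  moreover have "{Z i -` A \<inter> space M | A. A \<in> sets borel} \<subseteq> gen_sigma M (\<lambda>_::unit. \<xi>2)" if "i = 1" for i
    unfolding Z_def using that measurable_sigma_gen[of "\<lambda>_::unit. \<xi>2" "()" M]
    by (intro vimage_subset_gen_sigma) (auto intro!: borel_measurable_Pair)
  moreover have "{Z i -` A \<inter> space M | A. A \<in> sets borel} \<subseteq> gen_sigma M Y" if "i = 2" for i
    unfolding Z_def using that r
    by (intro vimage_subset_gen_sigma) (auto intro!: borel_measurable_Pair)
  ultimately show "P1.indep_sets (\<lambda>i. {Z i -` A \<inter> space M | A. A \<in> sets borel}) {0, 1, 2}"
    by (intro P1.indep_sets_mono_sets[OF indep]) auto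
qed

lemma measurable_fst_component:
  assumes "i \<in> I"
  shows "(\<lambda>z. fst (z i)) \<in> borel_measurable (PiM I (\<lambda>_. borel :: (real \<times> real) measure))"
proof -
  have "(fst :: real \<times> real \<Rightarrow> real) \<in> borel_measurable borel"
    by (intro borel_measurable_continuous_onI continuous_intros)
  moreover have "(\<lambda>z. z i) \<in> PiM I (\<lambda>_. borel :: (real \<times> real) measure) \<rightarrow>\<^sub>M borel"
    using assms by (rule measurable_component_singleton)
  ultimately show ?thesis by (rule measurable_compose[rotated])
qed

lemma indep_boundaries:
  fixes u w :: "real \<Rightarrow> real"
  assumes "u \<in> borel_measurable borel" "w \<in> borel_measurable borel"
  shows "P1.indep_var borel (\<lambda>\<omega>. u (\<xi>1 \<omega>)) borel (\<lambda>\<omega>. w (\<xi>2 \<omega>))"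
proof -
  define Z where "Z = (\<lambda>i::nat. if i = 0 then \<lambda>\<omega>. (\<xi>1 \<omega>, 0) else if i = 1 then \<lambda>\<omega>. (\<xi>2 \<omega>, 0)
     else (\<lambda>\<omega>. (run_sup (\<lambda>s \<omega>. - Y s \<omega>) 0 \<omega>, run_sup Y 0 \<omega>)))"
  have m: "(\<lambda>z. v (fst (z i))) \<in> borel_measurable (PiM {i} (\<lambda>_. borel :: (real \<times> real) measure))"
    if "v \<in> borel_measurable borel" for v :: "real \<Rightarrow> real" and i :: nat
    by (rule measurable_compose[OF measurable_fst_component that]) simp
  have "P1.indep_var (PiM {0} (\<lambda>_. borel)) (\<lambda>\<omega>. restrict (\<lambda>i. Z i \<omega>) {0})
     (PiM {1} (\<lambda>_. borel)) (\<lambda>\<omega>. restrict (\<lambda>i. Z i \<omega>) {1})"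
    unfolding Z_def by (rule P1.indep_var_restrict[OF indep_triple[of 0]]) auto
  from P1.indep_var_compose[OF this m[OF assms(1)] m[OF assms(2)]]
  show ?thesis by (simp add: comp_def Z_def)
qed

lemma indep_boundaries_path:
  assumes "t \<ge> 0"
  shows "P1.indep_var borel (\<lambda>\<omega>. (\<xi>1 \<omega>, \<xi>2 \<omega>)) borel
    (\<lambda>\<omega>. (run_sup (\<lambda>s \<omega>. - Y s \<omega>) t \<omega>, run_sup Y t \<omega>))"
proof -
  define Z where "Z = (\<lambda>i::nat. if i = 0 then \<lambda>\<omega>. (\<xi>1 \<omega>, 0) else if i = 1 then \<lambda>\<omega>. (\<xi>2 \<omega>, 0)
     else (\<lambda>\<omega>. (run_sup (\<lambda>s \<omega>. - Y s \<omega>) t \<omega>, run_sup Y t \<omega>)))"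
  have m: "(\<lambda>z. (fst (z 0), fst (z 1))) \<in> PiM {0::nat, 1} (\<lambda>_. borel :: (real \<times> real) measure) \<rightarrow>\<^sub>M borel"
    by (intro borel_measurable_Pair measurable_fst_component) auto
  have m': "(\<lambda>z. z 2) \<in> PiM {2::nat} (\<lambda>_. borel :: (real \<times> real) measure) \<rightarrow>\<^sub>M borel"
    by (rule measurable_component_singleton) simp
  have "P1.indep_var (PiM {0, 1} (\<lambda>_. borel)) (\<lambda>\<omega>. restrict (\<lambda>i. Z i \<omega>) {0, 1})
     (PiM {2} (\<lambda>_. borel)) (\<lambda>\<omega>. restrict (\<lambda>i. Z i \<omega>) {2})"
    unfolding Z_def by (rule P1.indep_var_restrict[OF indep_triple[OF assms]]) auto
  from P1.indep_var_compose[OF this m m']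
  show ?thesis by (simp add: comp_def Z_def)
qed

text \<open>Conditioning on the barriers: \<open>g\<close> is the indicator of the strip condition,
  and averaging it over the path with frozen barriers gives \<open>strip_prob\<close>.\<close>

lemma
  assumes t: "t \<ge> 0"
  shows strip_prob_measurable: "strip_prob t \<in> borel_measurable M"
    and rstay_sets: "rstay t \<in> sets M"
    and prob_rstay: "measure M (rstay t) = P1.expectation (strip_prob t)"
proof -
  let ?U = "\<lambda>\<omega>. (\<xi>1 \<omega>, \<xi>2 \<omega>)"
  let ?V = "\<lambda>\<omega>. (run_sup (\<lambda>s \<omega>. - Y s \<omega>) t \<omega>, run_sup Y t \<omega>)"
  define g :: "(real \<times> real) \<times> (real \<times> real) \<Rightarrow> real" where
    "g = indicator {z. fst (snd z) < fst (fst z) \<and> snd (snd z) < snd (fst z)}"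
  have iv: "P1.indep_var borel ?U borel ?V" by (rule indep_boundaries_path[OF t])
  have gm: "g \<in> borel_measurable (borel \<Otimes>\<^sub>M borel)"
  proof -
    have "{z :: (real \<times> real) \<times> (real \<times> real). fst (snd z) < fst (fst z) \<and> snd (snd z) < snd (fst z)} \<in> sets borel"
      by (intro borel_open open_Collect_conj open_Collect_less continuous_intros)
    then show ?thesis unfolding g_def borel_prod by simp
  qed
  have gb: "\<bar>g z\<bar> \<le> 1" for z by (auto simp: g_def indicator_def)
  have r': "run_sup Y t \<in> borel_measurable M" "run_sup (\<lambda>s \<omega>. - Y s \<omega>) t \<in> borel_measurable M"
    using t bm_continuous[OF BM] bm_measurable[OF BM]
    by (auto intro!: run_sup_measurable continuous_on_minus borel_measurable_uminus)
  note [measurable] = r' P1.rv P2.rv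
  show sets: "rstay t \<in> sets M" unfolding rstay_def stay_def by measurable
  have inner: "P1.expectation (\<lambda>\<omega>'. g (?U \<omega>, ?V \<omega>')) = strip_prob t \<omega>" for \<omega>
  proof -
    have "P1.expectation (\<lambda>\<omega>'. g (?U \<omega>, ?V \<omega>')) = P1.expectation (indicator (stay M Y t (\<xi>1 \<omega>) (\<xi>2 \<omega>)))"
      by (intro Bochner_Integration.integral_cong refl) (auto simp: g_def stay_def indicator_def)
    also have "\<dots> = strip_prob t \<omega>" unfolding strip_prob_def
      by (simp add: stay_def Int_def conj_commute cong: conj_cong)
    finally show ?thesis .
  qed
  show "strip_prob t \<in> borel_measurable M"
    using P1.borel_measurable_expectation_indep_pair[OF iv gm gb] by (simp add: inner)
  have "P1.expectation (\<lambda>\<omega>. g (?U \<omega>, ?V \<omega>)) = P1.expectation (strip_prob t)"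
    using P1.expectation_indep_pair[OF iv gm gb] by (simp add: inner)
  moreover have "P1.expectation (\<lambda>\<omega>. g (?U \<omega>, ?V \<omega>)) = P1.expectation (indicator (rstay t))"
    by (intro Bochner_Integration.integral_cong refl) (auto simp: g_def stay_def rstay_def indicator_def)
  moreover have "\<dots> = measure M (rstay t)"
    using sets.sets_into_space[OF sets] by (simp add: Int_absorb2)
  ultimately show "measure M (rstay t) = P1.expectation (strip_prob t)" by simp
qed

lemma integrable_strip_prob: "t \<ge> 0 \<Longrightarrow> integrable M (strip_prob t)"
  by (intro P1.integrable_const_bound[where B=1] strip_prob_measurable) (auto simp: strip_prob_def)

lemma trunc_moment_eq: "P2.trunc_moment k T = P1.trunc_moment k T" if "T > 0"
proof -
  have "ennreal (P2.trunc_moment k T) = (\<integral>\<^sup>+x. ennreal (f x) * ennreal (min 1 (x / T) ^ k) \<partial>lborel)"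
    unfolding P2.trunc_moment_eq_nn[OF that]
    by (rule distributed_nn_integral[OF P2.dens, symmetric]) measurable
  also have "\<dots> = ennreal (P1.trunc_moment k T)"
    unfolding P1.trunc_moment_eq_nn[OF that]
    by (rule distributed_nn_integral[OF P1.dens]) measurable
  finally show ?thesis
    using P1.trunc_moment_nonneg[OF that, of k] P2.trunc_moment_nonneg[OF that, of k] by simp
qed

lemma expectation_product:
  assumes "T > 0"
  shows "P1.expectation (\<lambda>\<omega>. min 1 (\<xi>1 \<omega> / T) ^ j * min 1 (\<xi>2 \<omega> / T) ^ k) = P1.trunc_moment j T * P1.trunc_moment k T"
    and "integrable M (\<lambda>\<omega>. min 1 (\<xi>1 \<omega> / T) ^ j * min 1 (\<xi>2 \<omega> / T) ^ k)"
proof -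
  have iv: "P1.indep_var borel (\<lambda>\<omega>. min 1 (\<xi>1 \<omega> / T) ^ j) borel (\<lambda>\<omega>. min 1 (\<xi>2 \<omega> / T) ^ k)"
    by (rule indep_boundaries) measurable
  show "P1.expectation (\<lambda>\<omega>. min 1 (\<xi>1 \<omega> / T) ^ j * min 1 (\<xi>2 \<omega> / T) ^ k) = P1.trunc_moment j T * P1.trunc_moment k T"
    unfolding P1.trunc_moment_def[of j] trunc_moment_eq[OF assms, of k, symmetric] P2.trunc_moment_def
    by (rule P1.indep_var_lebesgue_integral[OF iv P1.integrable_trunc[OF assms] P2.integrable_trunc[OF assms]])
  show "integrable M (\<lambda>\<omega>. min 1 (\<xi>1 \<omega> / T) ^ j * min 1 (\<xi>2 \<omega> / T) ^ k)"
    by (rule P1.indep_var_integrable[OF iv P1.integrable_trunc[OF assms] P2.integrable_trunc[OF assms]])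
qed

text \<open>Adding the two orderings of the boundaries turns the minimum and the maximum of
  \<open>\<xi>1\<close>, \<open>\<xi>2\<close> into products of independent factors.\<close>

lemma strip_prob_le:
  fixes k :: nat
  assumes t: "t > 0" and k: "k > 0" and \<omega>: "\<omega> \<in> space M"
  defines "T \<equiv> sqrt t"
  shows "strip_prob t \<omega> \<le> 2 * sqrt 2 * (2 * sqrt (2 * k)) ^ k *
    (min 1 (\<xi>1 \<omega> / T) ^ 1 * min 1 (\<xi>2 \<omega> / T) ^ k + min 1 (\<xi>1 \<omega> / T) ^ k * min 1 (\<xi>2 \<omega> / T) ^ 1)"
proof -
  have T: "T > 0" using t by (simp add: T_def)
  \<comment> \<open>Here \<open>b\<close> is the nearer barrier, so a + b \<le> 2 a. Constants leave
    the truncation by min 1 (c x) \<le> c min 1 x for c \<ge> 1.\<close>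
  have main: "measure M (stay M Z t a b) \<le> 2 * sqrt 2 * (2 * sqrt (2 * k)) ^ k * (min 1 (b / T) * min 1 (a / T) ^ k)"
    if Z: "brownian_motion M Z" and ab: "0 < b" "b \<le> a" for Z :: "real \<Rightarrow> 'a \<Rightarrow> real" and a b
  proof -
    have 1: "min 1 (2 * sqrt 2 * b / T) \<le> 2 * sqrt 2 * min 1 (b / T)"
    proof -
      have "1 \<le> sqrt (2::real)" by simp
      then have "1 \<le> 2 * sqrt 2 * (1::real)" by linarith
      then show ?thesis by (auto simp: min_def)
    qed
    have 2: "min 1 ((a + b) * sqrt (2 * k) / T) \<le> 2 * sqrt (2 * k) * min 1 (a / T)"
    proof -
      have "1 \<le> sqrt (2 * real k)" using k by (intro real_sqrt_ge_one) simp
      then have "1 \<le> 2 * sqrt (2 * real k) * 1" by linarith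
      moreover have "(a + b) * sqrt (2 * k) / T \<le> 2 * sqrt (2 * k) * (a / T)"
        using ab T mult_right_mono[of "a + b" "2 * a" "sqrt (2 * k)"] by (simp add: divide_right_mono mult_ac)
      ultimately show ?thesis by (auto simp: min_def)
    qed
    have "measure M (stay M Z t a b) \<le> min 1 (2 * sqrt 2 * b / T) * (min 1 ((a + b) * sqrt (2 * k) / T)) ^ k"
      unfolding T_def using ab t k by (intro bm_strip_le Z) auto
    also have "\<dots> \<le> (2 * sqrt 2 * min 1 (b / T)) * (2 * sqrt (2 * k) * min 1 (a / T)) ^ k"
      using 1 2 ab T by (intro mult_mono power_mono) auto
    also have "\<dots> = 2 * sqrt 2 * (2 * sqrt (2 * k)) ^ k * (min 1 (b / T) * min 1 (a / T) ^ k)"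
      by (simp only: power_mult_distrib mult_ac)
    finally show ?thesis .
  qed
  define K where "K = 2 * sqrt 2 * (2 * sqrt (2 * k)) ^ k"
  have K: "K \<ge> 0" by (simp add: K_def)
  have pos: "0 < \<xi>1 \<omega>" "0 < \<xi>2 \<omega>" using P1.pos P2.pos \<omega> by auto
  define u v where "u = min 1 (\<xi>1 \<omega> / T)" and "v = min 1 (\<xi>2 \<omega> / T)"
  have uv: "0 \<le> u" "0 \<le> v" using pos T by (auto simp: u_def v_def)
  show ?thesis
  proof (cases "\<xi>2 \<omega> \<le> \<xi>1 \<omega>")
    case True
    have "strip_prob t \<omega> \<le> K * (v * u ^ k)"
      unfolding strip_prob_def K_def u_def v_def using True pos by (intro main BM)
    also have "\<dots> \<le> K * (u ^ 1 * v ^ k + u ^ k * v ^ 1)"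
      using K uv by (intro mult_left_mono) auto
    finally show ?thesis by (simp add: K_def u_def v_def)
  next
    case False
    \<comment> \<open>Now the upper barrier is the farther one, and the path is reflected to
      exchange the two.\<close>
    have "strip_prob t \<omega> = measure M (stay M (\<lambda>t \<omega>. - Y t \<omega>) t (\<xi>2 \<omega>) (\<xi>1 \<omega>))"
      by (simp add: strip_prob_def stay_uminus)
    also have "\<dots> \<le> K * (u * v ^ k)"
      unfolding K_def u_def v_def using False pos by (intro main brownian_motion_uminus BM) auto
    also have "\<dots> \<le> K * (u ^ 1 * v ^ k + u ^ k * v ^ 1)"
      using K uv by (intro mult_left_mono) auto
    finally show ?thesis by (simp add: K_def u_def v_def)
  qed
qed

lemma prob_rstay_le:
  fixes k :: nat
  assumes t: "t > 0" and k: "k > 0"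
  shows "measure M (rstay t) \<le> 4 * sqrt 2 * (2 * sqrt (2 * k)) ^ k
     * (P1.trunc_moment 1 (sqrt t) * P1.trunc_moment k (sqrt t))"
proof -
  let ?T = "sqrt t"
  have T: "?T > 0" using t by simp
  define K where "K = 2 * sqrt 2 * (2 * sqrt (2 * k)) ^ k"
  have "measure M (rstay t) = P1.expectation (strip_prob t)"
    using t by (intro prob_rstay) simp
  also have "\<dots> \<le> P1.expectation (\<lambda>\<omega>. K *
    (min 1 (\<xi>1 \<omega> / ?T) ^ 1 * min 1 (\<xi>2 \<omega> / ?T) ^ k + min 1 (\<xi>1 \<omega> / ?T) ^ k * min 1 (\<xi>2 \<omega> / ?T) ^ 1))"
    unfolding K_def using t k
    by (intro integral_mono integrable_strip_prob integrable_mult_right Bochner_Integration.integrable_add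
        expectation_product(2) strip_prob_le) auto
  also have "\<dots> = K * (P1.trunc_moment 1 ?T * P1.trunc_moment k ?T + P1.trunc_moment k ?T * P1.trunc_moment 1 ?T)"
  proof -
    have "P1.expectation (\<lambda>\<omega>. min 1 (\<xi>1 \<omega> / ?T) ^ 1 * min 1 (\<xi>2 \<omega> / ?T) ^ k + min 1 (\<xi>1 \<omega> / ?T) ^ k * min 1 (\<xi>2 \<omega> / ?T) ^ 1)
       = P1.trunc_moment 1 ?T * P1.trunc_moment k ?T + P1.trunc_moment k ?T * P1.trunc_moment 1 ?T"
      unfolding expectation_product(1)[OF T, symmetric]
      by (intro Bochner_Integration.integral_add expectation_product(2)[OF T])
    then show ?thesis by (simp only: integral_mult_right_zero)
  qed
  finally show ?thesis by (simp add: K_def mult_ac)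
qed

text \<open>Discard everything except \<xi>2 \<ge> T. There \<open>bm_strip_ge_min\<close> applies
  whatever \<xi>1 is, and independence splits the expectation.\<close>

lemma prob_rstay_ge:
  assumes t: "t > 0" and x0: "x0 \<le> sqrt t"
  shows "exp (- 2 * pi\<^sup>2) / 3 * (P1.trunc_moment 1 (sqrt t) * (C / (2 * p) * sqrt t powr - p)) \<le> measure M (rstay t)"
proof -
  let ?T = "sqrt t"
  have T: "?T > 0" using t by simp
  define c where "c = exp (- 2 * pi\<^sup>2) / 3"
  have c: "c \<ge> 0" by (simp add: c_def)
  define w where "w x = (indicator {?T..} x :: real)" for x
  have wm [measurable]: "w \<in> borel_measurable borel" unfolding w_def[abs_def] by measurable
  have iv: "P1.indep_var borel (\<lambda>\<omega>. min 1 (\<xi>1 \<omega> / ?T) ^ 1) borel (\<lambda>\<omega>. w (\<xi>2 \<omega>))"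
    by (rule indep_boundaries) measurable
  have iw: "integrable M (\<lambda>\<omega>. w (\<xi>2 \<omega>))"
    using P2.rv by (intro P1.integrable_const_bound[where B=1]) (auto simp: w_def indicator_def)
  have ew: "P1.expectation (\<lambda>\<omega>. w (\<xi>2 \<omega>)) = P1.prob {\<omega>\<in>space M. ?T \<le> \<xi>2 \<omega>}"
  proof -
    have "P1.expectation (\<lambda>\<omega>. w (\<xi>2 \<omega>)) = P1.expectation (indicator {\<omega>\<in>space M. ?T \<le> \<xi>2 \<omega>})"
      by (intro Bochner_Integration.integral_cong refl) (auto simp: w_def indicator_def)
    then show ?thesis by (simp add: Int_def conj_commute cong: conj_cong)
  qed
  have "c * (P1.trunc_moment 1 ?T * (C / (2 * p) * ?T powr - p)) \<le> c * (P1.trunc_moment 1 ?T * P1.prob {\<omega>\<in>space M. ?T \<le> \<xi>2 \<omega>})"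
    using c P1.trunc_moment_nonneg[OF T] P2.tail_bounds(2)[OF x0] by (intro mult_left_mono) auto
  also have "\<dots> = c * P1.expectation (\<lambda>\<omega>. min 1 (\<xi>1 \<omega> / ?T) ^ 1 * w (\<xi>2 \<omega>))"
    using P1.indep_var_lebesgue_integral[OF iv P1.integrable_trunc[OF T] iw] by (simp add: P1.trunc_moment_def ew)
  also have "\<dots> = P1.expectation (\<lambda>\<omega>. c * (min 1 (\<xi>1 \<omega> / ?T) ^ 1 * w (\<xi>2 \<omega>)))"
    by simp
  also have "\<dots> \<le> P1.expectation (strip_prob t)"
  proof (rule integral_mono)
    show "integrable M (\<lambda>\<omega>. c * (min 1 (\<xi>1 \<omega> / ?T) ^ 1 * w (\<xi>2 \<omega>)))"
      by (intro integrable_mult_right P1.indep_var_integrable[OF iv P1.integrable_trunc[OF T] iw])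
    show "integrable M (strip_prob t)" using t by (intro integrable_strip_prob) simp
    fix \<omega> assume \<omega>: "\<omega> \<in> space M"
    show "c * (min 1 (\<xi>1 \<omega> / ?T) ^ 1 * w (\<xi>2 \<omega>)) \<le> strip_prob t \<omega>"
    proof (cases "?T \<le> \<xi>2 \<omega>")
      case True
      then show ?thesis using bm_strip_ge_min[OF BM t P1.pos[OF \<omega>] True]
        by (simp add: w_def strip_prob_def c_def)
    qed (simp add: w_def strip_prob_def)
  qed
  also have "\<dots> = measure M (rstay t)" using t by (intro prob_rstay[symmetric]) simp
  finally show ?thesis by (simp add: c_def)
qed

text \<open>Shows that almost every path leaves its strip. The crude bound 1 for the first moment
  suffices, as the other factor already decays.\<close>

lemma prob_rstay_tendsto_0: "((\<lambda>t. measure M (rstay t)) \<longlongrightarrow> 0) at_top"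
proof -
  obtain k :: nat where k: "p < k" using reals_Archimedean2 by blast
  then have k0: "k > 0" using P1.p by (cases "k = 0") simp_all
  define K where "K = 4 * sqrt 2 * (2 * sqrt (2 * k)) ^ k * (x0 ^ k + 2 * C / (k - p) + 2 * C / p)"
  have "\<forall>\<^sub>F t in at_top. measure M (rstay t) \<le> K * sqrt t powr - p"
    using eventually_ge_at_top[of "x0\<^sup>2"]
  proof eventually_elim
    case (elim t)
    have T: "x0 \<le> sqrt t" using elim by (rule real_le_rsqrt)
    have "0 < x0\<^sup>2" using P1.x0 by simp
    then have t: "t > 0" using elim by linarith
    have "measure M (rstay t) \<le> 4 * sqrt 2 * (2 * sqrt (2 * k)) ^ k
        * (P1.trunc_moment 1 (sqrt t) * P1.trunc_moment k (sqrt t))"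
      by (rule prob_rstay_le[OF t k0])
    also have "\<dots> \<le> 4 * sqrt 2 * (2 * sqrt (2 * k)) ^ k * (1 * ((x0 ^ k + 2 * C / (k - p) + 2 * C / p) * sqrt t powr - p))"
      using t P1.trunc_moment_le_1[of "sqrt t" 1] P1.trunc_moment_nonneg[of "sqrt t" k]
        P1.trunc_moment_high_le[OF k T]
      by (intro mult_left_mono mult_mono) auto
    finally show ?case by (simp add: K_def mult_ac)
  qed
  moreover have "((\<lambda>t. K * sqrt t powr - p) \<longlongrightarrow> 0) at_top"
  proof (rule tendsto_mult_right_zero)
    show "((\<lambda>t. sqrt t powr - p) \<longlongrightarrow> 0) at_top"
      using P1.p by (intro tendsto_neg_powr[OF _ sqrt_at_top]) simp
  qed
  ultimately show ?thesis
    by (rule tendsto_sandwich[OF _ _ tendsto_const, rotated]) simp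
qed

text \<open>If the path never leaves the strip, \<open>exit_time\<close> is the junk value \<open>Inf {}\<close>; this is
  harmless for \<open>t\<close> beyond that constant because the event has probability zero.\<close>

lemma exit_time_gt_eq:
  assumes t: "t \<ge> 0" "t \<ge> Inf {}"
  shows "{\<omega>\<in>space M. exit_time Y (\<lambda>\<omega>. - \<xi>1 \<omega>) \<xi>2 \<omega> > t} = rstay t - (\<Inter>n::nat. rstay (real n))"
proof -
  have "exit_time Y (\<lambda>\<omega>. - \<xi>1 \<omega>) \<xi>2 \<omega> > t \<longleftrightarrow> \<omega> \<in> rstay t \<and> (\<exists>n::nat. \<omega> \<notin> rstay (real n))"
    if \<omega>: "\<omega> \<in> space M" for \<omega>
  proof -
    define S where "S = {t. 0 \<le> t \<and> Y t \<omega> \<notin> {- \<xi>1 \<omega> <..< \<xi>2 \<omega>}}"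
    have mem: "\<omega> \<in> rstay r \<longleftrightarrow> S \<inter> {0..r} = {}" if "r \<ge> 0" for r
      using \<omega> that by (auto simp: rstay_eq S_def)
    have bdd: "bdd_below S" by (rule bdd_belowI[of _ 0]) (auto simp: S_def)
    have S0: "S \<subseteq> {0..}" by (auto simp: S_def)
    have cont: "continuous_on {0..} (\<lambda>t. Y t \<omega>)" by (rule bm_continuous[OF BM \<omega>])
    have closed: "closed S"
    proof -
      have "closed ({0..} \<inter> (\<lambda>t. Y t \<omega>) -` (- {- \<xi>1 \<omega> <..< \<xi>2 \<omega>}))"
        by (rule continuous_closed_preimage[OF cont]) auto
      moreover have "S = {0..} \<inter> (\<lambda>t. Y t \<omega>) -` (- {- \<xi>1 \<omega> <..< \<xi>2 \<omega>})" by (auto simp: S_def)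
      ultimately show ?thesis by simp
    qed
    \<comment> \<open>An empty \<open>S\<close> has infimum \<open>Inf {}\<close>, at most t by
      assumption. For nonempty \<open>S\<close>, closedness puts the infimum into \<open>S\<close>,
      so avoiding [0, t] yields a strict inequality.\<close>
    have "Inf S > t \<longleftrightarrow> S \<noteq> {} \<and> S \<inter> {0..t} = {}"
    proof
      assume less: "Inf S > t"
      have "S \<noteq> {}" using less t(2) by auto
      moreover have "s \<notin> {0..t}" if "s \<in> S" for s
        using cInf_lower[OF that bdd] less by auto
      ultimately show "S \<noteq> {} \<and> S \<inter> {0..t} = {}" by auto
    next
      assume *: "S \<noteq> {} \<and> S \<inter> {0..t} = {}"
      then have "Inf S \<in> S" using closed_contains_Inf[OF _ bdd closed] by simp
      then show "Inf S > t" using * S0 by force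
    qed
    moreover have "S \<noteq> {} \<longleftrightarrow> (\<exists>n::nat. \<omega> \<notin> rstay (real n))"
    proof
      assume "S \<noteq> {}"
      then obtain s where s: "s \<in> S" by blast
      obtain n :: nat where "s \<le> real n" using real_arch_simple by blast
      then have "s \<in> S \<inter> {0..real n}" using s S0 by auto
      then show "\<exists>n::nat. \<omega> \<notin> rstay (real n)" using mem[of "real n"] by auto
    qed (auto simp: mem)
    ultimately show ?thesis using t(1) by (auto simp: mem exit_time_def S_def)
  qed
  moreover have "rstay t \<subseteq> space M" by (auto simp: rstay_def)
  ultimately show ?thesis by auto
qed

lemma prob_exit_time_gt:
  assumes t: "t \<ge> 0" "t \<ge> Inf {}"
  shows "measure M {\<omega>\<in>space M. exit_time Y (\<lambda>\<omega>. - \<xi>1 \<omega>) \<xi>2 \<omega> > t} = measure M (rstay t)"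
proof -
  have sets: "(\<Inter>n::nat. rstay (real n)) \<in> sets M"
    by (intro sets.countable_INT) (auto intro!: rstay_sets)
  have "measure M (\<Inter>n::nat. rstay (real n)) \<le> 0"
  proof (rule tendsto_lowerbound)
    show "((\<lambda>n. measure M (rstay (real n))) \<longlongrightarrow> 0) sequentially"
      by (rule filterlim_compose[OF prob_rstay_tendsto_0 filterlim_real_sequentially])
    show "\<forall>\<^sub>F n in sequentially. measure M (\<Inter>n::nat. rstay (real n)) \<le> measure M (rstay (real n))"
      by (intro always_eventually allI P1.finite_measure_mono) (auto intro!: rstay_sets)
  qed simp
  then have "(\<Inter>n::nat. rstay (real n)) \<in> null_sets M"
    using sets by (auto simp: null_sets_def P1.emeasure_eq_measure measure_le_0_iff)
  then show ?thesis
    unfolding exit_time_gt_eq[OF t] using t by (intro measure_Diff_null_set rstay_sets)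
qed

end

section \<open>From rates in T to rates in t, and the final comparison\<close>

lemma rate_eq:
  assumes "t > 0"
  shows "(if p < 1 then t powr (- p) else if p = 1 then t powr (- 1) * ln t else t powr (- (p + 1) / 2))
    = (if p = 1 then 2 else 1) * (first_moment_rate p (sqrt t) * sqrt t powr - p)"
proof -
  have prod: "sqrt t powr x * sqrt t powr y = t powr ((x + y) / 2)" for x y
  proof -
    have "sqrt t powr x * sqrt t powr y = sqrt t powr (x + y)" by (rule powr_add[symmetric])
    also have "\<dots> = (t powr (1/2)) powr (x + y)" using assms by (simp add: powr_half_sqrt)
    also have "\<dots> = t powr ((x + y) / 2)" by (simp add: powr_powr)
    finally show ?thesis .
  qed
  \<comment> \<open>This halving is the origin of the factor 2 at p = 1.\<close>
  have ln: "ln (sqrt t) = ln t / 2" using assms by (simp add: ln_sqrt)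
  consider "p < 1" | "p = 1" | "p > 1" by linarith
  then show ?thesis
  proof cases
    case 1
    then show ?thesis using prod[of "- p" "- p"] by (simp add: first_moment_rate_def)
  next
    case 2
    then have "(if p = 1 then 2 else 1) * (first_moment_rate p (sqrt t) * sqrt t powr - p)
        = (sqrt t powr - 1 * sqrt t powr - 1) * ln t"
      by (simp only: first_moment_rate_def ln if_True if_False less_irrefl) (simp only: mult_ac times_divide_eq_right, simp)
    then show ?thesis using 2 prod[of "- 1" "- 1"] by (simp only: if_True if_False less_irrefl) simp
  next
    case 3
    then show ?thesis using prod[of "- 1" "- p"] by (simp add: first_moment_rate_def add.commute)
  qed
qed

theorem theorem3p1:
  fixes M :: "'a measure" and Y :: "real \<Rightarrow> 'a \<Rightarrow> real"
    and \<xi>1 \<xi>2 :: "'a \<Rightarrow> real" and f :: "real \<Rightarrow> real" and C p :: real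
  assumes BM: "brownian_motion M Y"
    and pos1: "\<forall>\<omega>\<in>space M. \<xi>1 \<omega> > 0" and pos2: "\<forall>\<omega>\<in>space M. \<xi>2 \<omega> > 0"
    and dens1: "distributed M lborel \<xi>1 (\<lambda>x. ennreal (f x))"
    and dens2: "distributed M lborel \<xi>2 (\<lambda>x. ennreal (f x))"
    and C: "C > 0" and p: "p > 0"
    and tail: "f \<sim>[at_top] (\<lambda>t. C * t powr (- p - 1))"
    and indep: "prob_space.indep_sets M
       (\<lambda>i::nat. if i = 0 then gen_sigma M (\<lambda>_::unit. \<xi>1)
                 else if i = 1 then gen_sigma M (\<lambda>_::unit. \<xi>2)
                 else gen_sigma M Y) {0, 1, 2}"
  shows "asymp_comparable
     (\<lambda>t. measure M {\<omega> \<in> space M. exit_time Y (\<lambda>\<omega>. - \<xi>1 \<omega>) \<xi>2 \<omega> > t})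
     (\<lambda>t. if p < 1 then t powr (- p)
          else if p = 1 then t powr (- 1) * ln t
          else t powr (- (p + 1) / 2))"
proof -
  interpret prob_space M by (rule bm_prob_space[OF BM])
  obtain x0 where x0: "x0 \<ge> 1" "\<And>x. x0 \<le> x \<Longrightarrow> C / 2 * x powr (- p - 1) \<le> f x \<and> f x \<le> 2 * C * x powr (- p - 1)"
    using power_tail_bounds[OF C tail] by blast
  have "power_tail M \<xi>1 f C p x0" "power_tail M \<xi>2 f C p x0"
    using pos1 pos2 dens1 dens2 C p x0 by (unfold_locales; simp)+
  then interpret random_strip M Y \<xi>1 \<xi>2 f C p x0
    using BM indep by (intro random_strip.intro)
  let ?g = "\<lambda>t. if p < 1 then t powr (- p) else if p = 1 then t powr (- 1) * ln t else t powr (- (p + 1) / 2)"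
  let ?P = "\<lambda>t. measure M {\<omega> \<in> space M. exit_time Y (\<lambda>\<omega>. - \<xi>1 \<omega>) \<xi>2 \<omega> > t}"
  obtain k :: nat where k: "p < k" using reals_Archimedean2 by blast
  then have k0: "k > 0" using p by (cases "k = 0") simp_all
  obtain c1 c2 where c: "c1 > 0" "c2 > 0" and ev: "\<forall>\<^sub>F T in at_top. c1 * first_moment_rate p T \<le> P1.trunc_moment 1 T
     \<and> P1.trunc_moment 1 T \<le> c2 * first_moment_rate p T"
    using P1.first_moment_bounds by blast
  define m :: real where "m = (if p = 1 then 2 else 1)"
  define L where "L = exp (- 2 * pi\<^sup>2) / 3"
  define K where "K = 4 * sqrt 2 * (2 * sqrt (2 * k)) ^ k"
  define D where "D = x0 ^ k + 2 * C / (k - p) + 2 * C / p"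
  define C1 where "C1 = L * c1 * (C / (2 * p)) / m"
  define C2 where "C2 = K * c2 * D / m"
  have "L > 0" "K > 0" "D > 0" "m > 0"
    using x0 C p k k0 by (auto simp: L_def K_def D_def m_def intro!: add_pos_pos zero_less_power mult_pos_pos)
  then have C12: "C1 > 0" "C2 > 0" using c C p by (auto simp: C1_def C2_def)
  \<comment> \<open>The thresholds serve in turn for the tail bounds at \<open>sqrt t\<close>, for
    passing the value \<open>Inf {}\<close> of paths that never exit, and for a positive
    logarithm.\<close>
  have bounds: "\<forall>\<^sub>F t in at_top. C1 \<le> ?P t / ?g t \<and> ?P t / ?g t \<le> C2"
    using eventually_compose_filterlim[OF ev sqrt_at_top]
      eventually_ge_at_top[of "x0\<^sup>2"] eventually_ge_at_top[of "Inf {} :: real"] eventually_gt_at_top[of "1::real"]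
  proof eventually_elim
    case (elim t)
    let ?T = "sqrt t" and ?r = "first_moment_rate p (sqrt t)"
    have t: "t > 0" and T1: "?T > 1" using elim by auto
    have T: "x0 \<le> ?T" using elim by (intro real_le_rsqrt) simp
    have P: "?P t = measure M (rstay t)" using elim by (intro prob_exit_time_gt) auto
    have r: "?r > 0" using T1 by (auto simp: first_moment_rate_def)
    then have g0: "?r * ?T powr - p > 0" using t by simp
    have g: "?g t = m * (?r * ?T powr - p)" unfolding m_def by (rule rate_eq[OF t])
    have "C1 * ?g t = L * ((c1 * ?r) * (C / (2 * p) * ?T powr - p))"
      using \<open>m > 0\<close> by (simp add: g C1_def)
    also have "\<dots> \<le> L * (P1.trunc_moment 1 ?T * (C / (2 * p) * ?T powr - p))"
      using elim \<open>L > 0\<close> C p by (intro mult_left_mono mult_right_mono) auto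
    also have "\<dots> \<le> ?P t" unfolding P L_def by (rule prob_rstay_ge[OF t T])
    finally have 1: "C1 * ?g t \<le> ?P t" .
    have "?P t \<le> K * (P1.trunc_moment 1 ?T * P1.trunc_moment k ?T)"
      unfolding P K_def by (rule prob_rstay_le[OF t k0])
    also have "\<dots> \<le> K * ((c2 * ?r) * (D * ?T powr - p))"
      using elim \<open>K > 0\<close> P1.trunc_moment_high_le[OF k T] P1.trunc_moment_nonneg[of ?T] t r c
      unfolding D_def by (intro mult_left_mono mult_mono) auto
    also have "\<dots> = C2 * ?g t" using \<open>m > 0\<close> by (simp add: g C2_def)
    finally have 2: "?P t \<le> C2 * ?g t" .
    have "?g t > 0" unfolding g using g0 \<open>m > 0\<close> by simp
    then show ?case using 1 2 by (simp only: pos_le_divide_eq pos_divide_le_eq)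
  qed
  \<comment> \<open>An eventual property along \<open>at_top\<close> holds at some t, where the
    ratio lies between both constants.\<close>
  moreover have "C1 \<le> C2"
  proof -
    obtain t where "C1 \<le> ?P t / ?g t \<and> ?P t / ?g t \<le> C2"
      using eventually_happens[OF bounds] by auto
    then show ?thesis by (meson order_trans)
  qed
  ultimately show ?thesis unfolding asymp_comparable_def using C12 by blast
qed

end
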